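(* If $A$ and $B$ are one-generated free algebras and $\tau:B\otimes A\to A\otimes B$ is a graded twisting map, then $A\otimes_\tau B$ is a Koszul algebra whenever it is quadratic.
   Context: $\mathbb K$ is a field, $\otimes=\otimes_{\mathbb K}$. Graded algebras are $\mathbb N$-graded associative unital $\mathbb K$-algebras, connected and locally finite dimensional; a one-generated free algebra is $T(V)$ with $V$ finite dimensional in degree $1$. $\mu_A$ is the multiplication of $A$; $1_A$ also denotes the identity map of $A$. Tensor products of graded spaces are graded by $(V\otimes W)_m=\bigoplus_{k+l=m}V_k\otimes W_l$; a linear map is graded if it preserves degree. A graded twisting map is a graded linear map $\tau:B\otimes A\to A\otimes B$ with $\tau(1_B\otimes a)=a\otimes 1_B$, $\tau(b\otimes 1_A)=1_A\otimes b$ and $\tau(\mu_B\otimes\mu_A)=(\mu_A\otimes\mu_B)(1_A\otimes\tau\otimes 1_B)(\tau\otimes\tau)(1_B\otimes\tau\otimes 1_A)$. Then $A\otimes_\tau B$ is the graded associative algebra with underlying space $A\otimes B$ and multiplication $(\mu_A\otimes\mu_B)(1_A\otimes\tau\otimes 1_B)$. A graded algebra $C$ is quadratic if $\pi:T(C_1)\to C$ is surjective with kernel generated as a two-sided ideal by $\ker\pi\cap(C_1\otimes C_1)$. $C$ is Koszul if $\mathbb K=C/C_+$ ($C_+=\bigoplus_{i>0}C_i$) has a resolution $\cdots\to P_1\to P_0\to\mathbb K\to0$ with each $P_i$ a graded free left $C$-module generated in degree $i$. *)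

theory Defs
  imports Complex_Main "HOL-Library.Poly_Mapping" "HOL-Algebra.QuotRing"
begin

text \<open>
  A vector space over a field \<open>'k\<close> is presented by a basis: \<open>'i \<Rightarrow>\<^sub>0 'k\<close> is the space with basis
  \<open>'i\<close>.  Then \<open>V \<otimes> W\<close> is the space with basis the product of the two bases, and a graded space
  is one whose basis vectors carry degrees, its \<open>n\<close>-th component being the span of the basis
  vectors of degree \<open>n\<close>.
\<close>

definition smul :: "'k::field \<Rightarrow> ('i \<Rightarrow>\<^sub>0 'k) \<Rightarrow> ('i \<Rightarrow>\<^sub>0 'k)" where
  "smul c f = Poly_Mapping.map (\<lambda>x. c * x) f"

abbreviation lin :: "(('i \<Rightarrow>\<^sub>0 'k::field) \<Rightarrow> ('j \<Rightarrow>\<^sub>0 'k)) \<Rightarrow> bool" where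
  "lin F \<equiv> Vector_Spaces.linear smul smul F"

definition bas :: "'i \<Rightarrow> ('i \<Rightarrow>\<^sub>0 'k::field)" where
  "bas i = Poly_Mapping.single i 1"

definition lin_ext :: "('i \<Rightarrow> ('j \<Rightarrow>\<^sub>0 'k)) \<Rightarrow> ('i \<Rightarrow>\<^sub>0 'k::field) \<Rightarrow> ('j \<Rightarrow>\<^sub>0 'k)" where
  "lin_ext g f = (\<Sum>i\<in>Poly_Mapping.keys f. smul (Poly_Mapping.lookup f i) (g i))"

definition tens :: "('i \<Rightarrow>\<^sub>0 'k::field) \<Rightarrow> ('j \<Rightarrow>\<^sub>0 'k) \<Rightarrow> ('i \<times> 'j \<Rightarrow>\<^sub>0 'k)" where
  "tens f g = lin_ext (\<lambda>i. lin_ext (\<lambda>j. bas (i, j)) g) f"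

definition tmap :: "(('i \<Rightarrow>\<^sub>0 'k::field) \<Rightarrow> ('p \<Rightarrow>\<^sub>0 'k)) \<Rightarrow> (('j \<Rightarrow>\<^sub>0 'k) \<Rightarrow> ('q \<Rightarrow>\<^sub>0 'k)) \<Rightarrow>
    ('i \<times> 'j \<Rightarrow>\<^sub>0 'k) \<Rightarrow> ('p \<times> 'q \<Rightarrow>\<^sub>0 'k)" where
  "tmap F G = lin_ext (\<lambda>(i, j). tens (F (bas i)) (G (bas j)))"

text \<open>
  The map \<open>1 \<otimes> t \<otimes> 1\<close>.  As tensor products are binary, fourfold products are bracketed
  \<open>(P \<otimes> Q) \<otimes> (R \<otimes> S)\<close> and are rebracketed to \<open>P \<otimes> ((Q \<otimes> R) \<otimes> S)\<close> and back.
\<close>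

definition mid :: "(('q \<times> 'r \<Rightarrow>\<^sub>0 'k::field) \<Rightarrow> ('u \<times> 'v \<Rightarrow>\<^sub>0 'k)) \<Rightarrow>
    (('p \<times> 'q) \<times> ('r \<times> 's) \<Rightarrow>\<^sub>0 'k) \<Rightarrow> (('p \<times> 'u) \<times> ('v \<times> 's) \<Rightarrow>\<^sub>0 'k)" where
  "mid t = lin_ext (\<lambda>(p, (u, v), s). bas ((p, u), (v, s)))
         \<circ> tmap id (tmap t id)
         \<circ> lin_ext (\<lambda>((p, q), (r, s)). bas (p, (q, r), s))"

definition hom_comp :: "('i \<Rightarrow> nat) \<Rightarrow> nat \<Rightarrow> ('i \<Rightarrow>\<^sub>0 'k::field) set" where
  "hom_comp d n = {f. \<forall>i\<in>Poly_Mapping.keys f. d i = n}"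

definition graded_map :: "('i \<Rightarrow> nat) \<Rightarrow> ('j \<Rightarrow> nat) \<Rightarrow> (('i \<Rightarrow>\<^sub>0 'k::field) \<Rightarrow> ('j \<Rightarrow>\<^sub>0 'k)) \<Rightarrow> bool" where
  "graded_map d e F \<longleftrightarrow> lin F \<and> (\<forall>n. F ` hom_comp d n \<subseteq> hom_comp e n)"

definition tdeg :: "('i \<Rightarrow> nat) \<Rightarrow> ('j \<Rightarrow> nat) \<Rightarrow> 'i \<times> 'j \<Rightarrow> nat" where
  "tdeg d e = (\<lambda>(i, j). d i + e j)"

record (overloaded) ('i, 'k) galg =
  gdeg :: "'i \<Rightarrow> nat"
  gone :: "'i \<Rightarrow>\<^sub>0 'k"
  gmul :: "('i \<times> 'i \<Rightarrow>\<^sub>0 'k) \<Rightarrow> ('i \<Rightarrow>\<^sub>0 'k)"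

definition gprod :: "('i, 'k::field) galg \<Rightarrow> ('i \<Rightarrow>\<^sub>0 'k) \<Rightarrow> ('i \<Rightarrow>\<^sub>0 'k) \<Rightarrow> ('i \<Rightarrow>\<^sub>0 'k)" where
  "gprod C a b = gmul C (tens a b)"

text \<open>Connected, locally finite dimensional, associative and unital.\<close>

definition graded_algebra :: "('i, 'k::field) galg \<Rightarrow> bool" where
  "graded_algebra C \<longleftrightarrow>
     graded_map (tdeg (gdeg C) (gdeg C)) (gdeg C) (gmul C) \<and>
     (\<forall>a b c. gprod C (gprod C a b) c = gprod C a (gprod C b c)) \<and>
     (\<forall>a. gprod C (gone C) a = a \<and> gprod C a (gone C) = a) \<and>
     hom_comp (gdeg C) 0 = range (\<lambda>c. smul c (gone C)) \<and>
     (\<forall>n. finite {i. gdeg C i = n})"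

definition galg_ring :: "('i, 'k::field) galg \<Rightarrow> ('i \<Rightarrow>\<^sub>0 'k) ring" where
  "galg_ring C = \<lparr>carrier = UNIV, mult = gprod C, one = gone C, zero = 0, add = (+)\<rparr>"

text \<open>The tensor algebra of the space with basis \<open>X\<close>: its basis consists of the words over \<open>X\<close>.\<close>

definition tensor_algebra :: "'x set \<Rightarrow> ('x list \<Rightarrow>\<^sub>0 'k::field) ring" where
  "tensor_algebra X =
     \<lparr>carrier = {f. Poly_Mapping.keys f \<subseteq> lists X},
      mult = (\<lambda>f g. lin_ext (\<lambda>(u, v). bas (u @ v)) (tens f g)),
      one = bas [], zero = 0, add = (+)\<rparr>"

text \<open>
  \<open>C\<close> is isomorphic as a graded algebra to \<open>T(V)\<close>, where \<open>V\<close> is finite dimensional, with basis \<open>X\<close>,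
  and placed in degree \<open>1\<close>.  Only the restriction of \<open>\<phi>\<close> to \<open>T(V)\<close> matters; every linear map on
  that subspace extends to the whole type.
\<close>

definition one_generated_free :: "('i, 'k::field) galg \<Rightarrow> bool" where
  "one_generated_free C \<longleftrightarrow>
     (\<exists>(X :: nat set) \<phi>. finite X \<and> lin \<phi> \<and>
        \<phi> \<in> ring_iso (tensor_algebra X) (galg_ring C) \<and>
        (\<forall>n. \<phi> ` (carrier (tensor_algebra X) \<inter> hom_comp length n) \<subseteq> hom_comp (gdeg C) n))"

definition graded_twisting_map ::
    "('i, 'k::field) galg \<Rightarrow> ('j, 'k) galg \<Rightarrow> (('j \<times> 'i \<Rightarrow>\<^sub>0 'k) \<Rightarrow> ('i \<times> 'j \<Rightarrow>\<^sub>0 'k)) \<Rightarrow> bool" where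
  "graded_twisting_map A B \<tau> \<longleftrightarrow>
     graded_map (tdeg (gdeg B) (gdeg A)) (tdeg (gdeg A) (gdeg B)) \<tau> \<and>
     (\<forall>a. \<tau> (tens (gone B) a) = tens a (gone B)) \<and>
     (\<forall>b. \<tau> (tens b (gone A)) = tens (gone A) b) \<and>
     \<tau> \<circ> tmap (gmul B) (gmul A) = tmap (gmul A) (gmul B) \<circ> mid \<tau> \<circ> tmap \<tau> \<tau> \<circ> mid \<tau>"

definition twisted_tensor ::
    "('i, 'k::field) galg \<Rightarrow> ('j, 'k) galg \<Rightarrow> (('j \<times> 'i \<Rightarrow>\<^sub>0 'k) \<Rightarrow> ('i \<times> 'j \<Rightarrow>\<^sub>0 'k)) \<Rightarrow>
     ('i \<times> 'j, 'k) galg" where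
  "twisted_tensor A B \<tau> =
     \<lparr>gdeg = tdeg (gdeg A) (gdeg B),
      gone = tens (gone A) (gone B),
      gmul = tmap (gmul A) (gmul B) \<circ> mid \<tau>\<rparr>"

definition tensor_degree_one :: "('i, 'k::field) galg \<Rightarrow> ('i list \<Rightarrow>\<^sub>0 'k) ring" where
  "tensor_degree_one C = tensor_algebra {i. gdeg C i = 1}"

definition canonical_map :: "('i, 'k::field) galg \<Rightarrow> ('i list \<Rightarrow>\<^sub>0 'k) \<Rightarrow> ('i \<Rightarrow>\<^sub>0 'k)" where
  "canonical_map C = lin_ext (\<lambda>w. foldr (\<lambda>i c. gprod C (bas i) c) w (gone C))"

definition canonical_kernel :: "('i, 'k::field) galg \<Rightarrow> ('i list \<Rightarrow>\<^sub>0 'k) set" where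
  "canonical_kernel C = {f \<in> carrier (tensor_degree_one C). canonical_map C f = 0}"

definition quadratic :: "('i, 'k::field) galg \<Rightarrow> bool" where
  "quadratic C \<longleftrightarrow>
     canonical_map C ` carrier (tensor_degree_one C) = UNIV \<and>
     canonical_kernel C = Idl\<^bsub>tensor_degree_one C\<^esub> (canonical_kernel C \<inter> hom_comp length 2)"

definition augmentation_ideal :: "('i, 'k::field) galg \<Rightarrow> ('i \<Rightarrow>\<^sub>0 'k) set" where
  "augmentation_ideal C = {f. \<forall>i\<in>Poly_Mapping.keys f. gdeg C i > 0}"

definition trivial_module :: "('i, 'k::field) galg \<Rightarrow> ('i \<Rightarrow>\<^sub>0 'k) set ring" where
  "trivial_module C = galg_ring C Quot augmentation_ideal C"

text \<open>
  The free left module \<open>C \<otimes> U\<close> on the space \<open>U\<close> with basis \<open>S\<close>; its action is multiplication on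
  the left factor.  If \<open>U\<close> is placed in degree \<open>n\<close>, the basis vector \<open>(i, s)\<close> has degree
  \<open>gdeg C i + n\<close>.
\<close>

definition free_module :: "'s set \<Rightarrow> ('i \<times> 's \<Rightarrow>\<^sub>0 'k::field) set" where
  "free_module S = {p. snd ` Poly_Mapping.keys p \<subseteq> S}"

definition act :: "('i, 'k::field) galg \<Rightarrow> ('i \<Rightarrow>\<^sub>0 'k) \<Rightarrow> ('i \<times> 's \<Rightarrow>\<^sub>0 'k) \<Rightarrow> ('i \<times> 's \<Rightarrow>\<^sub>0 'k)" where
  "act C c = tmap (gprod C c) id"

definition free_comp :: "('i, 'k::field) galg \<Rightarrow> 's set \<Rightarrow> nat \<Rightarrow> nat \<Rightarrow> ('i \<times> 's \<Rightarrow>\<^sub>0 'k) set" where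
  "free_comp C S n m = free_module S \<inter> hom_comp (tdeg (gdeg C) (\<lambda>_. n)) m"

text \<open>
  \<open>S n\<close> is a \<open>C\<close>-basis of \<open>P\<^sub>n\<close>, \<open>\<epsilon> : P\<^sub>0 \<rightarrow> C/C\<^sub>+\<close> and \<open>d n : P\<^bsub>n+1\<^esub> \<rightarrow> P\<^sub>n\<close>.  The target of \<open>\<epsilon>\<close> is
  concentrated in degree \<open>0\<close>.
\<close>

definition linear_free_resolution ::
    "('i, 'k::field) galg \<Rightarrow> (nat \<Rightarrow> 's set) \<Rightarrow> (('i \<times> 's \<Rightarrow>\<^sub>0 'k) \<Rightarrow> ('i \<Rightarrow>\<^sub>0 'k) set) \<Rightarrow>
     (nat \<Rightarrow> ('i \<times> 's \<Rightarrow>\<^sub>0 'k) \<Rightarrow> ('i \<times> 's \<Rightarrow>\<^sub>0 'k)) \<Rightarrow> bool" where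
  "linear_free_resolution C S \<epsilon> d \<longleftrightarrow>
     (\<forall>p\<in>free_module (S 0). \<forall>q\<in>free_module (S 0).
        \<epsilon> (p + q) = \<epsilon> p \<oplus>\<^bsub>trivial_module C\<^esub> \<epsilon> q) \<and>
     (\<forall>c. \<forall>p\<in>free_module (S 0).
        \<epsilon> (act C c p) =
          (augmentation_ideal C +>\<^bsub>galg_ring C\<^esub> c) \<otimes>\<^bsub>trivial_module C\<^esub> \<epsilon> p) \<and>
     (\<forall>m>0. \<forall>p\<in>free_comp C (S 0) 0 m. \<epsilon> p = \<zero>\<^bsub>trivial_module C\<^esub>) \<and>
     (\<forall>n. \<forall>p\<in>free_module (S (Suc n)). \<forall>q\<in>free_module (S (Suc n)).
        d n (p + q) = d n p + d n q) \<and>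
     (\<forall>n c. \<forall>p\<in>free_module (S (Suc n)). d n (act C c p) = act C c (d n p)) \<and>
     (\<forall>n m. d n ` free_comp C (S (Suc n)) (Suc n) m \<subseteq> free_comp C (S n) n m) \<and>
     \<epsilon> ` free_module (S 0) = carrier (trivial_module C) \<and>
     d 0 ` free_module (S 1) = {p \<in> free_module (S 0). \<epsilon> p = \<zero>\<^bsub>trivial_module C\<^esub>} \<and>
     (\<forall>n. d (Suc n) ` free_module (S (Suc (Suc n))) =
            {p \<in> free_module (S (Suc n)). d n p = 0})"

text \<open>
  Basis sets of natural numbers suffice: if \<open>C\<close> is locally finite dimensional and \<open>P\<close> is a
  resolution with each \<open>P\<^sub>n\<close> free and generated in degree \<open>n\<close>, then by induction on \<open>n\<close> each \<open>P\<^sub>n\<close>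
  has a finite basis, because its basis elements map injectively into a space of the form
  \<open>C\<^sub>1 \<otimes> U\<close> with \<open>U\<close> finite dimensional.
\<close>

definition koszul :: "('i, 'k::field) galg \<Rightarrow> bool" where
  "koszul C \<longleftrightarrow> (\<exists>(S :: nat \<Rightarrow> nat set) \<epsilon> d. linear_free_resolution C S \<epsilon> d)"

end

theory Submission
  imports Defs
begin

text \<open>
  Let \<open>C = A \<otimes>\<^sub>\<tau> B\<close>, with \<open>A\<close> and \<open>B\<close> free on \<open>a\<close> and \<open>b\<close> generators.  Then \<open>dim C\<^sub>n = \<Sum>\<^sub>k a\<^sup>k b\<^bsup>n-k\<^esup>\<close>,
  so the Hilbert series of \<open>C\<close> is \<open>1 / (1 - (a + b) t + a b t\<^sup>2)\<close>.  Let \<open>R\<close> be the space of quadratic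
  relations, which has dimension \<open>(a + b)\<^sup>2 - dim C\<^sub>2 = a b\<close>.  For every quadratic algebra the complex
  \<open>C \<otimes> R \<rightarrow> C \<otimes> C\<^sub>1 \<rightarrow> C \<rightarrow> K \<rightarrow> 0\<close> is exact.  Here its graded Euler characteristic vanishes, so
  \<open>C \<otimes> R \<rightarrow> C \<otimes> C\<^sub>1\<close> is injective and the complex is a linear free resolution.
\<close>

section \<open>Linear algebra over spaces with a basis\<close>

text \<open>Exactness at C \<otimes> C_1 comes from splitting off the last letter of a word. A cycle
  in C \<otimes> C_1 lifts to a relation, and a relation is a sum of terms u r v with r quadratic.
  Terms with v nonempty die in C \<otimes> C_1, because r is 0 in C; terms with v empty are
  boundaries. What is special to the twisted product is injectivity on C \<otimes> R. A direct
  approach would rewrite each product y x with y in B_1 and x in A_1 as \<tau>(y \<otimes> x), which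
  is where the number a b of relations comes from. But \<tau>(y \<otimes> x) may have components in
  A_2 and B_2, and inside a longer word these can create new products y x, so there is no evident
  normal form. Dimensions avoid this: as a graded space C is A \<otimes> B whatever \<tau> is, and
  its series is the product of 1 / (1 - a t) and 1 / (1 - b t). As C may be infinite dimensional,
  the count is made in each degree separately. The definition of \<open>twisted_tensor\<close> only
  supplies data, so associativity has to be derived from the axioms of \<tau> before any of this
  applies.\<close>

lemma lookup_smul [simp]: "Poly_Mapping.lookup (smul c f) i = c * Poly_Mapping.lookup f i"
  unfolding smul_def by (simp add: Poly_Mapping.map.rep_eq when_def)

interpretation vs: vector_space "smul :: 'k::field \<Rightarrow> ('i \<Rightarrow>\<^sub>0 'k) \<Rightarrow> ('i \<Rightarrow>\<^sub>0 'k)"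
  by unfold_locales (auto intro!: poly_mapping_eqI simp: lookup_add algebra_simps)

interpretation vsp: vector_space_pair "smul :: 'k::field \<Rightarrow> ('i \<Rightarrow>\<^sub>0 'k) \<Rightarrow> ('i \<Rightarrow>\<^sub>0 'k)"
    "smul :: 'k::field \<Rightarrow> ('j \<Rightarrow>\<^sub>0 'k) \<Rightarrow> ('j \<Rightarrow>\<^sub>0 'k)"
  by unfold_locales

lemma linI:
  assumes "\<And>x y. F (x + y) = F x + F y" "\<And>c x. F (smul c x) = smul c (F x)"
  shows "lin F"
  unfolding Vector_Spaces.linear_iff by (simp add: assms vs.vector_space_axioms)

lemma lin_add: "lin F \<Longrightarrow> F (x + y) = F x + F y"
  by (rule vsp.linear_add)

lemma lin_smul: "lin F \<Longrightarrow> F (smul c x) = smul c (F x)"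
  by (rule vsp.linear_scale)

lemma lin_zero: "lin F \<Longrightarrow> F 0 = 0"
  by (rule vsp.linear_0)

lemma lin_minus: "lin F \<Longrightarrow> F (- x) = - F x"
  by (rule vsp.linear_neg)

lemma lin_sum: "lin F \<Longrightarrow> F (sum g S) = (\<Sum>i\<in>S. F (g i))"
  by (rule vsp.linear_sum)

lemma lin_id [simp]: "lin (\<lambda>x. x)"
  by (rule linI) auto

lemma lin_id' [simp]: "lin id"
  by (rule linI) auto

lemma lin_const_zero [simp]: "lin (\<lambda>x. 0)"
  by (rule linI) auto

lemma lin_comp: "lin F \<Longrightarrow> lin G \<Longrightarrow> lin (\<lambda>x. F (G x))"
  by (rule linI) (simp_all add: lin_add lin_smul)

lemma lookup_bas: "Poly_Mapping.lookup (bas i) j = (if i = j then 1 else 0)"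
  by (simp add: bas_def lookup_single when_def)

lemma keys_bas [simp]: "Poly_Mapping.keys (bas i :: _ \<Rightarrow>\<^sub>0 'k::field) = {i}"
  by (simp add: bas_def)

lemma bas_eq_iff [simp]: "bas i = (bas j :: _ \<Rightarrow>\<^sub>0 'k::field) \<longleftrightarrow> i = j"
  by (metis keys_bas singleton_inject)

lemma bas_nonzero [simp]: "bas i \<noteq> (0 :: _ \<Rightarrow>\<^sub>0 'k::field)"
  by (metis keys_bas keys_zero insert_not_empty)

lemma keys_smul: "Poly_Mapping.keys (smul c f) \<subseteq> Poly_Mapping.keys f"
  by (auto simp: in_keys_iff)

lemma bas_expansion:
  fixes f :: "'i \<Rightarrow>\<^sub>0 'k::field"
  shows "f = (\<Sum>i\<in>Poly_Mapping.keys f. smul (Poly_Mapping.lookup f i) (bas i))"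
  by (rule poly_mapping_eqI)
     (simp add: lookup_sum lookup_bas if_distrib in_keys_iff cong: if_cong)

text \<open>\<open>lin_ext\<close> sums over the support of its argument, which changes under
  addition and scaling. Over a common finite superset the sums become comparable.\<close>

lemma lin_ext_superset:
  assumes "finite S" "Poly_Mapping.keys f \<subseteq> S"
  shows "lin_ext g f = (\<Sum>i\<in>S. smul (Poly_Mapping.lookup f i) (g i))"
  unfolding lin_ext_def using assms
  by (intro sum.mono_neutral_left) (auto simp: in_keys_iff)

lemma lin_lin_ext [simp, intro]:
  fixes g :: "'i \<Rightarrow> ('j \<Rightarrow>\<^sub>0 'k::field)"
  shows "lin (lin_ext g)"
proof (rule linI)
  fix x y :: "'i \<Rightarrow>\<^sub>0 'k" and c :: 'k
  let ?S = "Poly_Mapping.keys x \<union> Poly_Mapping.keys y"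
  have fin: "finite ?S" by simp
  show "lin_ext g (x + y) = lin_ext g x + lin_ext g y"
    by (simp add: lin_ext_superset[OF fin] keys_add lookup_add vs.scale_left_distrib sum.distrib)
  show "lin_ext g (smul c x) = smul c (lin_ext g x)"
    using keys_smul[of c x]
    by (simp add: lin_ext_superset[OF finite_keys[of x]] vs.scale_sum_right)
qed

lemma lin_ext_bas [simp]: "lin_ext g (bas i) = g i"
  by (simp add: lin_ext_def lookup_bas)

lemma lin_apply_expand:
  assumes "lin F"
  shows "F f = (\<Sum>i\<in>Poly_Mapping.keys f. smul (Poly_Mapping.lookup f i) (F (bas i)))"
  by (subst bas_expansion[of f]) (simp add: lin_sum[OF assms] lin_smul[OF assms])

lemma lin_eq_lin_ext: "lin F \<Longrightarrow> F f = lin_ext (\<lambda>i. F (bas i)) f"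
  unfolding lin_ext_def by (rule lin_apply_expand)

text \<open>Testing on the support only, rather than on all basis vectors, lets membership of
  \<open>f\<close> in a free module or a tensor algebra be used for each basis vector.\<close>

lemma lin_eq_on_keys:
  assumes "lin F" "lin G" "\<And>i. i \<in> Poly_Mapping.keys f \<Longrightarrow> F (bas i) = G (bas i)"
  shows "F f = G f"
  using assms(3) by (simp add: lin_apply_expand[OF assms(1), of f] lin_apply_expand[OF assms(2), of f])

lemma lin_eqI:
  assumes "lin F" "lin G" "\<And>i. F (bas i) = G (bas i)"
  shows "F f = G f"
  by (rule lin_eq_on_keys[OF assms])

lemma lin_lin_ext_apply: "lin F \<Longrightarrow> F (lin_ext g x) = lin_ext (\<lambda>i. F (g i)) x"
  by (rule lin_eqI[of "\<lambda>x. F (lin_ext g x)" "lin_ext (\<lambda>i. F (g i))"])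
     (auto intro: lin_comp)

lemma lin_ext_cong:
  "(\<And>i. i \<in> Poly_Mapping.keys x \<Longrightarrow> g i = h i) \<Longrightarrow> x = y \<Longrightarrow> lin_ext g x = lin_ext h y"
  by (auto simp: lin_ext_def)

text \<open>Linearity in the family instead of the argument. This is what makes
  \<open>tens f\<close> linear, and the module action linear in the scalar.\<close>

lemma lin_ext_fun_lin:
  assumes "\<And>i. lin (\<lambda>x. g x i)"
  shows "lin (\<lambda>x. lin_ext (g x) f)"
  unfolding lin_ext_def
  by (rule linI)
     (simp_all add: lin_add[OF assms] lin_smul[OF assms] vs.scale_right_distrib sum.distrib
        vs.scale_sum_right mult.commute)

lemma lin_ext_bas_id [simp]: "lin_ext bas x = x"
  using bas_expansion[of x] by (simp add: lin_ext_def)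

subsection \<open>Tensor products\<close>

lemma lin_tens_left: "lin (\<lambda>f. tens f g)"
  unfolding tens_def by simp

lemma lin_tens_right: "lin (tens f)"
  unfolding tens_def by (rule lin_ext_fun_lin) simp

lemmas lin_tens_simps =
  lin_add[OF lin_tens_left] lin_smul[OF lin_tens_left] lin_zero[OF lin_tens_left]
  lin_add[OF lin_tens_right] lin_smul[OF lin_tens_right] lin_zero[OF lin_tens_right]

lemma tens_bas [simp]: "tens (bas i) (bas j) = bas (i, j)"
  by (simp add: tens_def)

lemma lookup_tens:
  fixes f :: "'i \<Rightarrow>\<^sub>0 'k::field" and g :: "'j \<Rightarrow>\<^sub>0 'k"
  shows "Poly_Mapping.lookup (tens f g) (i, j) = Poly_Mapping.lookup f i * Poly_Mapping.lookup g j"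
proof -
  have "Poly_Mapping.lookup (lin_ext (\<lambda>j. bas (i', j)) g) (i, j) = (if i' = i then Poly_Mapping.lookup g j else 0)" for i'
    by (auto simp: lin_ext_def lookup_sum lookup_bas if_distrib in_keys_iff cong: if_cong)
  then show ?thesis
    by (simp only: tens_def lin_ext_def[of _ f] lookup_sum lookup_smul) (simp add: if_distrib in_keys_iff cong: if_cong)
qed

lemma keys_tens: "Poly_Mapping.keys (tens f g) = Poly_Mapping.keys f \<times> Poly_Mapping.keys g"
  by (auto simp: in_keys_iff lookup_tens)

lemma lin_tmap [simp, intro]: "lin (tmap F G)"
  unfolding tmap_def by simp

lemma tmap_bas [simp]: "tmap F G (bas (i, j)) = tens (F (bas i)) (G (bas j))"
  by (simp add: tmap_def)

lemma bilin_eqI: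
  assumes "\<And>y. lin (\<lambda>x. F x y)" "\<And>x. lin (F x)" "\<And>y. lin (\<lambda>x. G x y)" "\<And>x. lin (G x)"
    and "\<And>i j. F (bas i) (bas j) = G (bas i) (bas j)"
  shows "F x y = G x y"
proof -
  have "F (bas i) y = G (bas i) y" for i
    by (rule lin_eqI[OF assms(2,4,5)])
  then show ?thesis
    by (rule lin_eqI[OF assms(1,3)])
qed

lemma tmap_tens:
  assumes "lin F" "lin G"
  shows "tmap F G (tens x y) = tens (F x) (G y)"
  by (rule bilin_eqI[of "\<lambda>x y. tmap F G (tens x y)" "\<lambda>x y. tens (F x) (G y)"])
     (auto intro!: lin_comp[OF lin_tmap] lin_comp[OF lin_tens_left] lin_comp[OF lin_tens_right]
        lin_tens_left lin_tens_right assms)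


section \<open>Coordinate subspaces, the common form of graded components, free modules and tensor
  algebras\<close>

definition coord_space :: "'i set \<Rightarrow> ('i \<Rightarrow>\<^sub>0 'k::field) set" where
  "coord_space S = {f. Poly_Mapping.keys f \<subseteq> S}"

lemma subspace_coord_space [simp, intro]:
  "vs.subspace (coord_space S :: ('i \<Rightarrow>\<^sub>0 'k::field) set)"
proof -
  have "coord_space S = {f :: 'i \<Rightarrow>\<^sub>0 'k. \<forall>i. i \<notin> S \<longrightarrow> Poly_Mapping.lookup f i = 0}"
    by (auto simp: coord_space_def in_keys_iff)
  then show ?thesis
    by (simp add: vs.subspace_def lookup_add)
qed

lemma bas_in_coord_space [simp]: "bas i \<in> coord_space S \<longleftrightarrow> i \<in> S"
  by (simp add: coord_space_def)

lemma span_bas_image: "vs.span (bas ` S) = (coord_space S :: ('i \<Rightarrow>\<^sub>0 'k::field) set)"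
proof (intro subset_antisym subsetI)
  fix f :: "'i \<Rightarrow>\<^sub>0 'k" assume "f \<in> vs.span (bas ` S)"
  moreover have "vs.span (bas ` S) \<subseteq> (coord_space S :: ('i \<Rightarrow>\<^sub>0 'k) set)"
    by (rule vs.span_minimal) auto
  ultimately show "f \<in> coord_space S" by blast
next
  fix f :: "'i \<Rightarrow>\<^sub>0 'k" assume "f \<in> coord_space S"
  then have "(\<Sum>i\<in>Poly_Mapping.keys f. smul (Poly_Mapping.lookup f i) (bas i)) \<in> vs.span (bas ` S)"
    by (intro vs.span_sum vs.span_scale vs.span_base) (auto simp: coord_space_def)
  then show "f \<in> vs.span (bas ` S)"
    using bas_expansion[of f] by simp
qed

lemma lookup_sum_smul_bas:
  assumes "finite t"
  shows "Poly_Mapping.lookup (\<Sum>i\<in>t. smul (u i) (bas i)) j = (if j \<in> t then u j else 0)"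
  using assms by (simp add: lookup_sum lookup_bas if_distrib cong: if_cong)

lemma independent_bas: "vs.independent (bas ` S :: ('i \<Rightarrow>\<^sub>0 'k::field) set)"
  unfolding vs.independent_explicit_module
proof (intro allI impI)
  fix t u and v :: "'i \<Rightarrow>\<^sub>0 'k" assume t: "finite t" "t \<subseteq> bas ` S"
    and z: "(\<Sum>v\<in>t. smul (u v) v) = 0" and v: "v \<in> t"
  obtain s where s: "s \<subseteq> S" "t = bas ` s" "finite s"
    using t by (meson finite_subset_image)
  have inj: "inj_on (bas :: _ \<Rightarrow> 'i \<Rightarrow>\<^sub>0 'k) s" by (simp add: inj_on_def)
  obtain i where i: "i \<in> s" "v = bas i" using v s by auto
  have "(\<Sum>i\<in>s. smul (u (bas i)) (bas i)) = 0"
    using z by (simp add: s sum.reindex[OF inj])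
  from arg_cong[OF this, of "\<lambda>f. Poly_Mapping.lookup f i"] show "u v = 0"
    using i s by (simp add: lookup_sum_smul_bas)
qed

lemma dim_coord_space: "vs.dim (coord_space S :: ('i \<Rightarrow>\<^sub>0 'k::field) set) = card S"
proof -
  have "vs.dim (coord_space S :: ('i \<Rightarrow>\<^sub>0 'k) set) = card (bas ` S :: ('i \<Rightarrow>\<^sub>0 'k) set)"
    unfolding span_bas_image[symmetric] by (rule vs.dim_span_eq_card_independent[OF independent_bas])
  also have "\<dots> = card S"
    by (rule card_image) (simp add: inj_on_def)
  finally show ?thesis .
qed

lemma independent_finite_card:
  fixes W :: "('i \<Rightarrow>\<^sub>0 'k::field) set"
  assumes "vs.independent W" "W \<subseteq> coord_space S" "finite S"
  shows "finite W \<and> card W \<le> card S"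
proof -
  have "finite W \<and> card W \<le> card (bas ` S :: ('i \<Rightarrow>\<^sub>0 'k) set)"
    by (rule vs.independent_span_bound) (use assms span_bas_image in auto)
  also have "card (bas ` S :: ('i \<Rightarrow>\<^sub>0 'k) set) = card S"
    by (rule card_image) (simp add: inj_on_def)
  finally show ?thesis .
qed

text \<open>The finite set \<open>S\<close> matters: \<open>vs.dim\<close> is 0 for infinite
  dimensional spaces too, as infinite sets have cardinality 0.\<close>

lemma dim_zero_imp_trivial:
  fixes V :: "('i \<Rightarrow>\<^sub>0 'k::field) set"
  assumes "V \<subseteq> coord_space S" "finite S" "vs.dim V = 0"
  shows "V \<subseteq> {0}"
proof -
  obtain W where W: "W \<subseteq> V" "vs.independent W" "V \<subseteq> vs.span W" "card W = vs.dim V"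
    using vs.basis_exists by blast
  have "finite W" using independent_finite_card[of W S] W assms by auto
  then have "W = {}" using W assms by simp
  then show ?thesis using W by simp
qed

text \<open>A basis of the kernel is extended to one of \<open>V\<close>, and \<open>F\<close>
  carries the added vectors to a basis of the image. It is stated for subspaces with finite
  coordinates because the ambient spaces are usually infinite dimensional.\<close>

lemma rank_nullity:
  fixes F :: "('i \<Rightarrow>\<^sub>0 'k::field) \<Rightarrow> ('j \<Rightarrow>\<^sub>0 'k)"
  assumes F: "lin F" and V: "vs.subspace V" "V \<subseteq> coord_space S" "finite S"
  shows "vs.dim V = vs.dim {x \<in> V. F x = 0} + vs.dim (F ` V)"
proof -
  let ?K = "{x \<in> V. F x = 0}"
  have K: "vs.subspace ?K"
    using V(1) by (auto simp: vs.subspace_def lin_add[OF F] lin_smul[OF F] lin_zero[OF F])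
  obtain W where W: "W \<subseteq> ?K" "vs.independent W" "?K \<subseteq> vs.span W" "card W = vs.dim ?K"
    using vs.basis_exists by blast
  obtain W' where W': "W \<subseteq> W'" "W' \<subseteq> V" "vs.independent W'" "V \<subseteq> vs.span W'"
    using vs.maximal_independent_subset_extend[of W V] W by blast
  have fin: "finite W'" using independent_finite_card[of W' S] W' V by auto
  have dimV: "vs.dim V = card W'"
    using vs.basis_card_eq_dim[of W' V] W' by simp
  let ?U = "W' - W"
  have spanU: "vs.span ?U \<subseteq> V"
    using W' V(1) by (intro vs.span_minimal) auto
  \<comment> \<open>Such an \<open>x\<close> also lies in the kernel, hence in the span of
    \<open>W\<close>. By independence of \<open>W'\<close> its unique expansion is supported both in
    \<open>W\<close> and in the disjoint set \<open>W' - W\<close>, so it is empty.\<close>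
  have triv: "x = 0" if x: "x \<in> vs.span ?U" and Fx: "F x = 0" for x
  proof -
    have W: "x \<in> vs.span W" using x Fx spanU W by auto
    have "vs.representation W' x = vs.representation W x"
      by (rule vs.representation_extend) (use W' W in auto)
    moreover have "vs.representation W' x = vs.representation ?U x"
      by (rule vs.representation_extend) (use W' x in auto)
    ultimately have "vs.representation W' x b = 0" for b
      using vs.representation_ne_zero[of W x b] vs.representation_ne_zero[of ?U x b] by auto
    moreover have "x \<in> vs.span W'" using W W'(1) vs.span_mono by blast
    ultimately show "x = 0"
      using vs.sum_nonzero_representation_eq[OF W'(3), of x] by simp
  qed
  have inj: "inj_on F (vs.span ?U)"
    using vsp.linear_inj_on_iff_eq_0[OF F vs.subspace_span] triv by blast
  have indep: "vs.independent (F ` ?U)"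
    using vsp.linear_independent_injective_image[OF F] inj W' vs.independent_mono by blast
  have "F ` V \<subseteq> vs.span (F ` ?U)"
  proof
    fix y assume "y \<in> F ` V"
    then obtain x where x: "x \<in> V" "y = F x" by blast
    have "F x \<in> F ` vs.span W'" using x W' by blast
    also have "\<dots> = vs.span (F ` W')" by (simp add: vsp.linear_span_image[OF F])
    also have "\<dots> \<subseteq> vs.span (F ` ?U)"
    proof (rule vs.span_minimal)
      show "F ` W' \<subseteq> vs.span (F ` ?U)"
      proof
        fix z assume "z \<in> F ` W'"
        then obtain w where w: "w \<in> W'" "z = F w" by blast
        then show "z \<in> vs.span (F ` ?U)"
          using W(1) by (cases "w \<in> W") (auto intro: vs.span_base simp: vs.span_zero subset_iff)
      qed
    qed simp
    finally show "y \<in> vs.span (F ` ?U)" using x by simp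
  qed
  then have "vs.dim (F ` V) = card (F ` ?U)"
    by (rule vs.basis_card_eq_dim[symmetric, rotated]) (use indep W'(2) in blast)+
  also have "\<dots> = card ?U"
    by (rule card_image) (rule inj_on_subset[OF inj vs.span_superset])
  finally show ?thesis
    using W(4) W'(1) fin dimV card_mono[OF fin W'(1)]
    by (simp add: card_Diff_subset finite_subset)
qed

lemma lin_ext_in_subspace:
  assumes "vs.subspace V" "\<And>i. i \<in> Poly_Mapping.keys f \<Longrightarrow> g i \<in> V"
  shows "lin_ext g f \<in> V"
  unfolding lin_ext_def by (intro vs.subspace_sum vs.subspace_scale assms)

lemma lin_in_subspace:
  assumes "lin F" "vs.subspace V" "\<And>i. i \<in> Poly_Mapping.keys f \<Longrightarrow> F (bas i) \<in> V"
  shows "F f \<in> V"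
  by (subst lin_eq_lin_ext[OF assms(1)], rule lin_ext_in_subspace) (use assms in auto)

lemma tens_in_coord_space:
  "x \<in> coord_space S \<Longrightarrow> y \<in> coord_space T \<Longrightarrow> S \<times> T \<subseteq> U \<Longrightarrow> tens x y \<in> coord_space U"
  by (auto simp: coord_space_def keys_tens)

section \<open>Homogeneous components and the projections onto them\<close>

lemma hom_comp_eq_coord_space: "hom_comp d n = coord_space {i. d i = n}"
  by (auto simp: hom_comp_def coord_space_def)

definition hproj :: "('i \<Rightarrow> nat) \<Rightarrow> nat \<Rightarrow> ('i \<Rightarrow>\<^sub>0 'k::field) \<Rightarrow> ('i \<Rightarrow>\<^sub>0 'k)" where
  "hproj d n = lin_ext (\<lambda>i. if d i = n then bas i else 0)"

lemma lin_hproj [simp]: "lin (hproj d n)"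
  by (simp add: hproj_def)

lemma lookup_hproj: "Poly_Mapping.lookup (hproj d n f) i = (if d i = n then Poly_Mapping.lookup f i else 0)"
proof -
  have "Poly_Mapping.lookup (hproj d n f) i =
      (\<Sum>j\<in>Poly_Mapping.keys f. if j = i \<and> d i = n then Poly_Mapping.lookup f i else 0)"
    by (auto simp: hproj_def lin_ext_def lookup_sum lookup_bas intro!: sum.cong)
  then show ?thesis
    by (cases "d i = n") (auto simp: in_keys_iff)
qed

lemma hproj_hom_comp: "f \<in> hom_comp d m \<Longrightarrow> hproj d n f = (if m = n then f else 0)"
  by (rule poly_mapping_eqI) (auto simp: lookup_hproj hom_comp_def in_keys_iff)

text \<open>\<open>F\<close> has to respect degrees on the support of \<open>f\<close> only. The
  canonical map does so on words over the generators, and the differentials on indices of actual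
  generators; their values elsewhere are arbitrary.\<close>

lemma hproj_commute:
  assumes "lin F" "\<And>i. i \<in> Poly_Mapping.keys f \<Longrightarrow> F (bas i) \<in> hom_comp e (d i)"
  shows "F (hproj d n f) = hproj e n (F f)"
proof (rule lin_eq_on_keys[of "\<lambda>f. F (hproj d n f)" "\<lambda>f. hproj e n (F f)"])
  fix i assume "i \<in> Poly_Mapping.keys f"
  then show "F (hproj d n (bas i)) = hproj e n (F (bas i))"
    using hproj_hom_comp[OF assms(2), of i n] by (auto simp: hproj_def lin_zero[OF assms(1)])
qed (auto intro: lin_comp assms)

lemma hproj_eq_0_imp:
  assumes "\<And>n. hproj d n f = 0"
  shows "f = 0"
proof (rule poly_mapping_eqI)
  fix i
  show "Poly_Mapping.lookup f i = Poly_Mapping.lookup 0 i"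
    using lookup_hproj[of d "d i" f i] by (simp add: assms)
qed

lemma hproj_in_coord_space: "f \<in> coord_space S \<Longrightarrow> hproj d n f \<in> coord_space {i \<in> S. d i = n}"
  by (auto simp: coord_space_def in_keys_iff lookup_hproj split: if_splits)

lemma coord_space_add: "x \<in> coord_space S \<Longrightarrow> y \<in> coord_space S \<Longrightarrow> x + y \<in> coord_space S"
  by (rule vs.subspace_add[OF subspace_coord_space])

lemma coord_space_neg: "x \<in> coord_space S \<Longrightarrow> - x \<in> coord_space S"
  by (rule vs.subspace_neg[OF subspace_coord_space])

lemma coord_space_0 [simp]: "0 \<in> coord_space S"
  by (rule vs.subspace_0[OF subspace_coord_space])

lemma coord_space_mono: "x \<in> coord_space S \<Longrightarrow> S \<subseteq> T \<Longrightarrow> x \<in> coord_space T"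
  by (auto simp: coord_space_def)

lemma coord_space_UNIV: "coord_space UNIV = UNIV"
  by (simp add: coord_space_def)

section \<open>The tensor algebra\<close>

definition conv :: "('x list \<Rightarrow>\<^sub>0 'k::field) \<Rightarrow> ('x list \<Rightarrow>\<^sub>0 'k) \<Rightarrow> ('x list \<Rightarrow>\<^sub>0 'k)" where
  "conv f g = lin_ext (\<lambda>(u, v). bas (u @ v)) (tens f g)"

lemma conv_bas [simp]: "conv (bas u) (bas v) = bas (u @ v)"
  by (simp add: conv_def)

lemma lin_conv_left: "lin (\<lambda>f. conv f g)"
  unfolding conv_def by (rule lin_comp[OF lin_lin_ext lin_tens_left])

lemma lin_conv_right: "lin (conv f)"
  unfolding conv_def by (rule lin_comp[OF lin_lin_ext lin_tens_right])

lemma conv_assoc: "conv (conv f g) h = conv f (conv g h)"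
proof -
  have "conv (conv (bas u) g) h = conv (bas u) (conv g h)" for u
    by (rule bilin_eqI[of "\<lambda>g h. conv (conv (bas u) g) h" "\<lambda>g h. conv (bas u) (conv g h)"])
       (auto intro: lin_comp lin_conv_left lin_conv_right lin_comp[OF lin_conv_left lin_conv_right]
          lin_comp[OF lin_conv_right lin_conv_left] lin_comp[OF lin_conv_right lin_conv_right])
  then show ?thesis
    by (rule lin_eqI[of "\<lambda>f. conv (conv f g) h" "\<lambda>f. conv f (conv g h)", rotated 2])
       (auto intro: lin_comp[OF lin_conv_left lin_conv_left] lin_conv_left)
qed

lemma conv_one [simp]: "conv (bas []) f = f" "conv f (bas []) = f"
  by (rule lin_eqI[of "conv (bas [])" "\<lambda>f. f"], auto intro: lin_conv_right)
     (rule lin_eqI[of "\<lambda>f. conv f (bas [])" "\<lambda>f. f"], auto intro: lin_conv_left)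

lemma conv_in_coord_space:
  assumes "f \<in> coord_space (lists X)" "g \<in> coord_space (lists X)"
  shows "conv f g \<in> coord_space (lists X)"
  unfolding conv_def
proof (rule lin_ext_in_subspace[OF subspace_coord_space])
  fix p assume "p \<in> Poly_Mapping.keys (tens f g)"
  then have "fst p \<in> lists X" "snd p \<in> lists X"
    using assms by (auto simp: coord_space_def keys_tens)
  then show "(case p of (u, v) \<Rightarrow> bas (u @ v)) \<in> coord_space (lists X)"
    by (cases p) (simp del: in_lists_conv_set)
qed

lemma tensor_algebra_simps [simp]:
  "carrier (tensor_algebra X) = coord_space (lists X)"
  "f \<otimes>\<^bsub>tensor_algebra X\<^esub> g = conv f g"
  "\<one>\<^bsub>tensor_algebra X\<^esub> = bas []"
  "\<zero>\<^bsub>tensor_algebra X\<^esub> = 0"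
  "f \<oplus>\<^bsub>tensor_algebra X\<^esub> g = f + g"
  by (simp_all add: tensor_algebra_def coord_space_def conv_def)

lemma ring_tensor_algebra: "ring (tensor_algebra X :: ('x list \<Rightarrow>\<^sub>0 'k::field) ring)"
proof (rule ringI)
  show "abelian_group (tensor_algebra X :: ('x list \<Rightarrow>\<^sub>0 'k) ring)"
    by (rule abelian_groupI)
       (auto simp: coord_space_add algebra_simps intro!: bexI[of _ "- x" for x] coord_space_neg)
  show "Group.monoid (tensor_algebra X :: ('x list \<Rightarrow>\<^sub>0 'k) ring)"
    by (rule monoidI) (auto simp: conv_assoc conv_in_coord_space)
qed (auto simp: lin_add[OF lin_conv_left] lin_add[OF lin_conv_right])

section \<open>Graded algebras\<close>

locale graded_alg =
  fixes C :: "('i, 'k::field) galg"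
  assumes graded_algebra: "graded_algebra C"
begin

abbreviation times (infixl "\<star>" 70) where "x \<star> y \<equiv> gprod C x y"
abbreviation "unit \<equiv> gone C"
abbreviation "deg \<equiv> gdeg C"

lemma lin_gmul: "lin (gmul C)"
  using graded_algebra by (simp add: graded_algebra_def graded_map_def)

lemma lin_left: "lin (\<lambda>x. x \<star> y)"
  unfolding gprod_def by (rule lin_comp[OF lin_gmul lin_tens_left])

lemma lin_right: "lin (gprod C x)"
  unfolding gprod_def by (rule lin_comp[OF lin_gmul lin_tens_right])

lemmas gprod_simps =
  lin_add[OF lin_left] lin_smul[OF lin_left] lin_zero[OF lin_left]
  lin_add[OF lin_right] lin_smul[OF lin_right] lin_zero[OF lin_right]

lemma gprod_assoc: "x \<star> y \<star> z = x \<star> (y \<star> z)"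
  and unit_left [simp]: "unit \<star> x = x"
  and unit_right [simp]: "x \<star> unit = x"
  using graded_algebra by (simp_all add: graded_algebra_def)

lemma finite_deg: "finite {i. deg i = n}"
  and hom_comp_0: "hom_comp deg 0 = range (\<lambda>c. smul c unit)"
  using graded_algebra by (simp_all add: graded_algebra_def)

lemma gprod_hom_comp:
  assumes "x \<in> hom_comp deg m" "y \<in> hom_comp deg n"
  shows "x \<star> y \<in> hom_comp deg (m + n)"
proof -
  have "tens x y \<in> hom_comp (tdeg deg deg) (m + n)"
    using assms by (auto simp: hom_comp_def keys_tens tdeg_def)
  then show ?thesis
    using graded_algebra by (auto simp: graded_algebra_def graded_map_def gprod_def)
qed

lemma bas_hom_comp: "bas i \<in> hom_comp deg (deg i)"
  by (simp add: hom_comp_def)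

lemma unit_hom_comp: "unit \<in> hom_comp deg 0"
  unfolding hom_comp_0 using rangeI[of "\<lambda>c. smul c unit" 1] by simp

text \<open>A zero unit would annihilate everything, but basis vectors are nonzero and the index
  type is inhabited.\<close>

lemma unit_nonzero: "unit \<noteq> 0"
proof
  assume "unit = 0"
  then have "bas i = (0 :: 'i \<Rightarrow>\<^sub>0 'k)" for i
    using unit_left[of "bas i"] by (simp add: gprod_simps)
  then show False by simp
qed

text \<open>The component of degree 0 is the line through the unit, so any basis vector of degree 0
  is a nonzero multiple of the unit and has the same support. The unit itself need not be a basis
  vector, hence the formulation by supports.\<close>

lemma deg_0_unique: "\<exists>i. {j. deg j = 0} = {i} \<and> Poly_Mapping.keys unit = {i}"
proof -
  have *: "Poly_Mapping.keys unit = {j}" if "deg j = 0" for j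
  proof -
    have "(bas j :: 'i \<Rightarrow>\<^sub>0 'k) \<in> hom_comp deg 0" using bas_hom_comp[of j] that by simp
    then obtain c where c: "bas j = smul c unit" unfolding hom_comp_0 by blast
    have "c \<noteq> 0" using c by (metis bas_nonzero vs.scale_zero_left)
    then have "Poly_Mapping.keys (smul c unit) = Poly_Mapping.keys unit"
      by (auto simp: in_keys_iff)
    then show ?thesis using c by (metis keys_bas)
  qed
  obtain i where "i \<in> Poly_Mapping.keys unit"
    using unit_nonzero by fastforce
  moreover from this have "deg i = 0"
    using unit_hom_comp by (auto simp: hom_comp_def)
  ultimately show ?thesis using * by blast
qed

definition "i0 = (THE i. Poly_Mapping.keys unit = {i})"

lemma keys_unit: "Poly_Mapping.keys unit = {i0}"
  using deg_0_unique by (auto simp: i0_def)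

lemma deg_0_eq: "{j. deg j = 0} = {i0}"
  using deg_0_unique keys_unit by auto

lemma deg_0_iff: "deg j = 0 \<longleftrightarrow> j = i0"
  using deg_0_eq by auto

lemma lookup_unit_nonzero: "Poly_Mapping.lookup unit i0 \<noteq> 0"
  using keys_unit by (simp flip: in_keys_iff)

lemma galg_ring_simps [simp]:
  "carrier (galg_ring C) = UNIV" "x \<otimes>\<^bsub>galg_ring C\<^esub> y = x \<star> y"
  "\<one>\<^bsub>galg_ring C\<^esub> = unit" "\<zero>\<^bsub>galg_ring C\<^esub> = 0" "x \<oplus>\<^bsub>galg_ring C\<^esub> y = x + y"
  by (simp_all add: galg_ring_def)

lemma ring_galg_ring: "ring (galg_ring C)"
proof (rule ringI)
  show "abelian_group (galg_ring C)"
    by (rule abelian_groupI)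
       (auto simp: algebra_simps intro!: exI[of _ "- x" for x])
  show "Group.monoid (galg_ring C)"
    by (rule monoidI) (auto simp: gprod_assoc)
qed (auto simp: gprod_simps)

lemma augmentation_ideal_eq: "augmentation_ideal C = coord_space {i. deg i > 0}"
  by (auto simp: augmentation_ideal_def coord_space_def)

lemma gprod_augmentation:
  assumes "x \<in> augmentation_ideal C \<or> y \<in> augmentation_ideal C"
  shows "x \<star> y \<in> augmentation_ideal C"
proof -
  have "gmul C (tens x y) \<in> augmentation_ideal C"
  proof (rule lin_in_subspace[OF lin_gmul])
    show "vs.subspace (augmentation_ideal C)" by (simp add: augmentation_ideal_eq)
    fix p assume p: "p \<in> Poly_Mapping.keys (tens x y)"
    obtain i j where ij: "p = (i, j)" by force
    have "deg i + deg j > 0"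
      using p assms ij by (auto simp: keys_tens augmentation_ideal_def)
    then show "gmul C (bas p) \<in> augmentation_ideal C"
      using gprod_hom_comp[OF bas_hom_comp[of i] bas_hom_comp[of j]] ij
      by (auto simp: gprod_def augmentation_ideal_def hom_comp_def)
  qed
  then show ?thesis by (simp add: gprod_def)
qed

lemma ideal_augmentation: "ideal (augmentation_ideal C) (galg_ring C)"
proof (rule idealI[OF ring_galg_ring])
  interpret ring "galg_ring C" by (rule ring_galg_ring)
  show "subgroup (augmentation_ideal C) (add_monoid (galg_ring C))"
  proof (rule add.subgroupI)
    fix a assume "a \<in> augmentation_ideal C"
    moreover have "\<ominus>\<^bsub>galg_ring C\<^esub> a = - a"
      by (rule minus_equality) auto
    ultimately show "\<ominus>\<^bsub>galg_ring C\<^esub> a \<in> augmentation_ideal C"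
      by (simp add: augmentation_ideal_eq coord_space_neg)
  qed (auto simp: augmentation_ideal_eq coord_space_add intro: coord_space_0)
qed (auto intro: gprod_augmentation)

subsection \<open>The canonical map\<close>

abbreviation "\<pi> \<equiv> canonical_map C"
abbreviation "D \<equiv> {i. deg i = 1}"

lemma lin_canonical: "lin \<pi>"
  by (simp add: canonical_map_def)

lemma canonical_Nil [simp]: "\<pi> (bas []) = unit"
  and canonical_Cons: "\<pi> (bas (i # w)) = bas i \<star> \<pi> (bas w)"
  by (simp_all add: canonical_map_def)

lemma canonical_single: "\<pi> (bas [i]) = bas i"
  by (simp add: canonical_Cons)

lemma canonical_append: "\<pi> (bas (u @ v)) = \<pi> (bas u) \<star> \<pi> (bas v)"
  by (induction u) (simp_all add: canonical_Cons gprod_assoc)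

lemma canonical_conv: "\<pi> (conv f g) = \<pi> f \<star> \<pi> g"
  by (rule bilin_eqI[of "\<lambda>f g. \<pi> (conv f g)" "\<lambda>f g. \<pi> f \<star> \<pi> g"])
     (auto intro!: lin_comp[OF lin_canonical lin_conv_left] lin_comp[OF lin_canonical lin_conv_right]
        lin_comp[OF lin_left lin_canonical] lin_comp[OF lin_right lin_canonical] simp: canonical_append)

lemma canonical_hom_comp: "w \<in> lists D \<Longrightarrow> \<pi> (bas w) \<in> hom_comp deg (length w)"
proof (induction w)
  case (Cons i w)
  then show ?case
    using gprod_hom_comp[OF bas_hom_comp[of i], of "\<pi> (bas w)" "length w"] by (simp add: canonical_Cons)
qed (simp add: unit_hom_comp)

text \<open>The canonical map preserves degrees and the empty word is the only word of length 0, so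
  the constant term of \<open>f\<close> can be read off from its image. This is how relations are
  seen to have no constant term.\<close>

lemma lookup_canonical_i0:
  assumes "f \<in> coord_space (lists D)"
  shows "Poly_Mapping.lookup (\<pi> f) i0 = Poly_Mapping.lookup f [] * Poly_Mapping.lookup unit i0"
proof -
  have "hproj deg 0 (\<pi> f) = \<pi> (hproj length 0 f)"
    by (rule hproj_commute[symmetric, OF lin_canonical])
       (rule canonical_hom_comp, use assms in \<open>unfold coord_space_def, blast\<close>)
  also have "hproj length 0 f = smul (Poly_Mapping.lookup f []) (bas [])"
    by (rule poly_mapping_eqI) (auto simp: lookup_hproj lookup_bas)
  finally have "hproj deg 0 (\<pi> f) = smul (Poly_Mapping.lookup f []) unit"
    by (simp add: lin_smul[OF lin_canonical])
  from arg_cong[OF this, of "\<lambda>f. Poly_Mapping.lookup f i0"] show ?thesis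
    by (simp add: lookup_hproj deg_0_iff)
qed

subsection \<open>Free modules\<close>

lemma act_unit: "act C unit p = p"
proof (rule lin_eqI[of "act C unit" "\<lambda>p. p"])
  fix x show "act C unit (bas x) = bas x"
    by (cases x) (simp add: act_def)
qed (auto simp: act_def)

lemma lin_act: "lin (act C c)"
  by (simp add: act_def)

lemma act_tens: "act C c (tens x y) = tens (c \<star> x) y"
  unfolding act_def using tmap_tens[OF lin_right lin_id'] by simp

lemma lin_act_left: "lin (\<lambda>c. act C c p)"
  unfolding act_def tmap_def
  by (rule lin_ext_fun_lin)
     (auto simp: case_prod_beta intro!: lin_comp[OF lin_tens_left lin_left])

lemma act_act: "act C a (act C b p) = act C (a \<star> b) p"
proof (rule lin_eqI[of "\<lambda>p. act C a (act C b p)" "act C (a \<star> b)"])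
  fix x show "act C a (act C b (bas x)) = act C (a \<star> b) (bas x)"
    by (cases x) (simp add: act_tens gprod_assoc flip: tens_bas)
qed (auto intro: lin_act lin_comp)

end

lemma free_module_eq: "free_module S = coord_space (UNIV \<times> S)"
  by (auto simp: free_module_def coord_space_def)

lemma free_comp_eq: "free_comp C S n m = coord_space {(i, s). s \<in> S \<and> gdeg C i + n = m}"
  by (auto simp: free_comp_def free_module_def hom_comp_def coord_space_def tdeg_def)

section \<open>The linear resolution of a quadratic algebra\<close>

text \<open>\<open>\<kappa>\<close> enumerates the basis of C_1, and \<open>z\<close> a family
  spanning the quadratic relations R. The index sets consist of natural numbers because
  \<open>koszul\<close> asks for bases of this form. Independence of the relations is expressed
  later, through the cardinality of \<open>S2\<close> in \<open>d1_inj\<close>.\<close>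

locale quadratic_presentation = graded_alg C for C :: "('i, 'k::field) galg" +
  fixes S1 S2 :: "nat set" and \<kappa> :: "nat \<Rightarrow> 'i" and z :: "nat \<Rightarrow> ('i list \<Rightarrow>\<^sub>0 'k)"
  assumes quadratic: "quadratic C"
    and bij_\<kappa>: "bij_betw \<kappa> S1 D"
    and span_z: "vs.span (z ` S2) = canonical_kernel C \<inter> hom_comp length 2"
begin

definition "\<iota> = inv_into S1 \<kappa>"

lemma \<kappa>_deg: "s \<in> S1 \<Longrightarrow> deg (\<kappa> s) = 1"
  using bij_\<kappa> by (auto simp: bij_betw_def)

lemma \<iota>_\<kappa>: "s \<in> S1 \<Longrightarrow> \<iota> (\<kappa> s) = s"
  using bij_\<kappa> by (simp add: \<iota>_def bij_betw_def)

lemma \<iota>_in: "deg i = 1 \<Longrightarrow> \<iota> i \<in> S1"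
  and \<kappa>_\<iota>: "deg i = 1 \<Longrightarrow> \<kappa> (\<iota> i) = i"
  using bij_\<kappa> by (auto simp: \<iota>_def bij_betw_def inv_into_into f_inv_into_f)

text \<open>Tensors without constant term form T(C_1) \<otimes> C_1; this is its projection to C
  \<otimes> C_1. The last letter is kept since C acts on the left factor. The empty word has no last
  letter and is sent to 0 by convention, so the lemmas below that multiply on the left or apply
  \<open>\<mu>\<close> exclude it.\<close>

definition split_last :: "('i list \<Rightarrow>\<^sub>0 'k) \<Rightarrow> ('i \<times> nat \<Rightarrow>\<^sub>0 'k)" where
  "split_last = lin_ext (\<lambda>w. if w = [] then 0 else tens (\<pi> (bas (butlast w))) (bas (\<iota> (last w))))"

definition \<mu> :: "('i \<times> nat \<Rightarrow>\<^sub>0 'k) \<Rightarrow> ('i \<Rightarrow>\<^sub>0 'k)" where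
  "\<mu> = lin_ext (\<lambda>(i, s). bas i \<star> bas (\<kappa> s))"

text \<open>The left C-linear map C \<otimes> R \<rightarrow> C \<otimes> C_1 that extends the
  inclusion of R into C_1 \<otimes> C_1.\<close>

definition d1 :: "('i \<times> nat \<Rightarrow>\<^sub>0 'k) \<Rightarrow> ('i \<times> nat \<Rightarrow>\<^sub>0 'k)" where
  "d1 = lin_ext (\<lambda>(i, s). act C (bas i) (split_last (z s)))"

lemma lin_split_last: "lin split_last" and lin_\<mu>: "lin \<mu>" and lin_d1: "lin d1"
  by (simp_all add: split_last_def \<mu>_def d1_def)

lemma split_last_snoc: "split_last (bas (w @ [a])) = tens (\<pi> (bas w)) (bas (\<iota> a))"
  by (simp add: split_last_def)

lemma \<mu>_tens: "\<mu> (tens x (bas s)) = x \<star> bas (\<kappa> s)"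
  by (rule lin_eqI[of "\<lambda>x. \<mu> (tens x (bas s))" "\<lambda>x. x \<star> bas (\<kappa> s)"])
     (auto intro: lin_comp[OF lin_\<mu> lin_tens_left] lin_left, simp add: \<mu>_def)

lemma \<mu>_act: "\<mu> (act C c p) = c \<star> \<mu> p"
proof (rule lin_eqI[of "\<lambda>p. \<mu> (act C c p)" "\<lambda>p. c \<star> \<mu> p"])
  fix x :: "'i \<times> nat"
  show "\<mu> (act C c (bas x)) = c \<star> \<mu> (bas x)"
    by (cases x) (simp add: act_tens \<mu>_tens gprod_assoc flip: tens_bas)
qed (auto intro: lin_comp lin_act lin_right lin_\<mu>)

lemma d1_tens: "d1 (tens x (bas s)) = act C x (split_last (z s))"
  by (rule lin_eqI[of "\<lambda>x. d1 (tens x (bas s))" "\<lambda>x. act C x (split_last (z s))"])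
     (auto intro: lin_comp[OF lin_d1 lin_tens_left] lin_act_left, simp add: d1_def)

lemma d1_act: "d1 (act C c p) = act C c (d1 p)"
proof (rule lin_eqI[of "\<lambda>p. d1 (act C c p)" "\<lambda>p. act C c (d1 p)"])
  fix x :: "'i \<times> nat"
  show "d1 (act C c (bas x)) = act C c (d1 (bas x))"
    by (cases x) (simp add: act_tens d1_tens act_act flip: tens_bas)
qed (auto intro: lin_comp lin_act lin_d1)

text \<open>A prefix does not touch the last letter. The empty word must be excluded: after
  multiplication by \<open>g\<close> it becomes \<open>g\<close>, which may have a last letter,
  whereas \<open>split_last\<close> has discarded it.\<close>

lemma split_last_conv_left:
  assumes "[] \<notin> Poly_Mapping.keys f"
  shows "split_last (conv g f) = act C (\<pi> g) (split_last f)"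
proof (rule lin_eq_on_keys[of "\<lambda>f. split_last (conv g f)" "\<lambda>f. act C (\<pi> g) (split_last f)"])
  fix w assume "w \<in> Poly_Mapping.keys f"
  then have "w \<noteq> []" using assms by auto
  then obtain v a where w: "w = v @ [a]" by (metis append_butlast_last_id)
  show "split_last (conv g (bas w)) = act C (\<pi> g) (split_last (bas w))"
  proof (rule lin_eqI[of "\<lambda>g. split_last (conv g (bas w))" "\<lambda>g. act C (\<pi> g) (split_last (bas w))"])
    fix u
    have "split_last (bas ((u @ v) @ [a])) = act C (\<pi> (bas u)) (split_last (bas (v @ [a])))"
      unfolding split_last_snoc act_tens canonical_append ..
    then show "split_last (conv (bas u) (bas w)) = act C (\<pi> (bas u)) (split_last (bas w))"
      by (simp add: w)
  qed (auto intro: lin_comp[OF lin_split_last lin_conv_left] lin_comp[OF lin_act_left lin_canonical])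
qed (auto intro: lin_comp[OF lin_split_last lin_conv_right] lin_comp[OF lin_act lin_split_last])

text \<open>Behind a nonempty suffix the last letter belongs to the suffix, so \<open>f\<close>
  survives only through its image in C. In particular the result is 0 when \<open>f\<close> is a
  relation.\<close>

lemma split_last_conv_snoc: "split_last (conv f (bas (v @ [a]))) = tens (\<pi> f \<star> \<pi> (bas v)) (bas (\<iota> a))"
proof (rule lin_eqI[of "\<lambda>f. split_last (conv f (bas (v @ [a])))" "\<lambda>f. tens (\<pi> f \<star> \<pi> (bas v)) (bas (\<iota> a))"])
  show "lin (\<lambda>f. tens (\<pi> f \<star> \<pi> (bas v)) (bas (\<iota> a)))"
    by (rule lin_comp[OF lin_comp[OF lin_tens_left lin_left] lin_canonical])
  fix u
  show "split_last (conv (bas u) (bas (v @ [a]))) = tens (\<pi> (bas u) \<star> \<pi> (bas v)) (bas (\<iota> a))"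
    using split_last_snoc[of "u @ v" a] by (simp add: canonical_append)
qed (auto intro: lin_comp[OF lin_split_last lin_conv_left])

text \<open>Multiplying the detached letter back in recovers the canonical map. This yields both
  that \<open>\<mu>\<close> kills boundaries and that it reaches the whole augmentation
  ideal.\<close>

lemma \<mu>_split_last:
  assumes "f \<in> coord_space (lists D)" "[] \<notin> Poly_Mapping.keys f"
  shows "\<mu> (split_last f) = \<pi> f"
proof (rule lin_eq_on_keys[of "\<lambda>f. \<mu> (split_last f)" \<pi>])
  fix w assume "w \<in> Poly_Mapping.keys f"
  then have "w \<noteq> []" "w \<in> lists D" using assms by (auto simp: coord_space_def)
  then obtain v a where w: "w = v @ [a]" "deg a = 1" by (cases w rule: rev_cases) auto
  then show "\<mu> (split_last (bas w)) = \<pi> (bas w)"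
    by (simp add: split_last_snoc \<mu>_tens \<kappa>_\<iota> canonical_append canonical_single)
qed (auto intro: lin_comp lin_\<mu> lin_split_last lin_canonical)

lemma split_last_in:
  assumes "f \<in> coord_space (lists D)"
  shows "split_last f \<in> free_module S1"
  unfolding split_last_def free_module_eq
proof (rule lin_ext_in_subspace[OF subspace_coord_space])
  fix w assume "w \<in> Poly_Mapping.keys f"
  then have "w \<in> lists D" using assms by (auto simp: coord_space_def)
  then show "(if w = [] then 0 else tens (\<pi> (bas (butlast w))) (bas (\<iota> (last w)))) \<in> coord_space (UNIV \<times> S1)"
    by (cases w rule: rev_cases)
       (auto intro!: tens_in_coord_space[of _ UNIV _ S1] simp: \<iota>_in coord_space_UNIV)
qed

lemma canonical_kernel_eq: "canonical_kernel C = {f \<in> coord_space (lists D). \<pi> f = 0}"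
  by (simp add: canonical_kernel_def tensor_degree_one_def)

lemma canonical_surj: obtains f where "f \<in> coord_space (lists D)" "\<pi> f = x"
proof -
  have "x \<in> \<pi> ` coord_space (lists D)"
    using quadratic by (simp add: quadratic_def tensor_degree_one_def)
  then show ?thesis using that by auto
qed

lemma Nil_notin_keys:
  assumes "f \<in> coord_space (lists D)" "\<pi> f \<in> augmentation_ideal C"
  shows "[] \<notin> Poly_Mapping.keys f"
proof -
  have "Poly_Mapping.lookup (\<pi> f) i0 = 0"
    using assms(2) deg_0_iff[of i0] unfolding augmentation_ideal_def
    by (metis (mono_tags, lifting) in_keys_iff less_irrefl mem_Collect_eq)
  then show ?thesis
    using lookup_canonical_i0[OF assms(1)] lookup_unit_nonzero by (simp add: in_keys_iff)
qed

lemma Nil_notin_keys_kernel: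
  "f \<in> coord_space (lists D) \<Longrightarrow> \<pi> f = 0 \<Longrightarrow> [] \<notin> Poly_Mapping.keys f"
  by (rule Nil_notin_keys) (simp_all add: augmentation_ideal_eq)

lemma z_in:
  assumes "s \<in> S2"
  shows "z s \<in> coord_space (lists D)" "\<pi> (z s) = 0" "z s \<in> hom_comp length 2"
proof -
  have "z s \<in> vs.span (z ` S2)" using assms by (auto intro: vs.span_base)
  then show "z s \<in> coord_space (lists D)" "\<pi> (z s) = 0" "z s \<in> hom_comp length 2"
    unfolding span_z by (auto simp: canonical_kernel_eq)
qed

lemma tens_in_free_module: "s \<in> S \<Longrightarrow> tens x (bas s) \<in> free_module S"
  by (auto simp: free_module_eq coord_space_UNIV intro!: tens_in_coord_space[of _ UNIV _ S])

lemma act_in_free_module: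
  assumes "p \<in> free_module S"
  shows "act C c p \<in> free_module S"
  unfolding free_module_eq
proof (rule lin_in_subspace[OF lin_act subspace_coord_space])
  fix x assume "x \<in> Poly_Mapping.keys p"
  then have "snd x \<in> S" using assms by (auto simp: free_module_def)
  then show "act C c (bas x) \<in> coord_space (UNIV \<times> S)"
    by (cases x) (simp add: act_tens tens_in_free_module flip: tens_bas free_module_eq)
qed

definition "im1 = d1 ` free_module S2"

lemma im1_eqI: "p \<in> free_module S2 \<Longrightarrow> d1 p = x \<Longrightarrow> x \<in> im1"
  by (auto simp: im1_def)

lemma subspace_im1: "vs.subspace im1"
  unfolding im1_def free_module_eq
  by (rule vsp.linear_subspace_image[OF lin_d1 subspace_coord_space])

lemmas im1_add = vs.subspace_add[OF subspace_im1]
  and im1_smul = vs.subspace_scale[OF subspace_im1]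
  and im1_0 = vs.subspace_0[OF subspace_im1]

lemma im1_act: "x \<in> im1 \<Longrightarrow> act C c x \<in> im1"
  by (auto simp: im1_def simp flip: d1_act intro: act_in_free_module)

lemma split_last_z_in_im1: "s \<in> S2 \<Longrightarrow> split_last (z s) \<in> im1"
  by (rule im1_eqI[OF tens_in_free_module[of s S2 unit]])
     (simp_all add: d1_tens act_unit)

text \<open>
  The relations that \<^const>\<open>split_last\<close> maps to boundaries form a two-sided ideal of the tensor
  algebra that contains the quadratic ones.  So it contains every relation, which is exactness at
  \<open>C \<otimes> C\<^sub>1\<close>.
\<close>

definition "kernel_ideal = {f \<in> coord_space (lists D). \<pi> f = 0 \<and> split_last f \<in> im1}"

lemma ideal_kernel_ideal: "ideal kernel_ideal (tensor_degree_one C)"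
  unfolding tensor_degree_one_def
proof (rule idealI[OF ring_tensor_algebra])
  interpret ring "tensor_algebra D :: ('i list \<Rightarrow>\<^sub>0 'k) ring" by (rule ring_tensor_algebra)
  show "subgroup kernel_ideal (add_monoid (tensor_algebra D))"
  proof (rule add.subgroupI)
    show "kernel_ideal \<subseteq> carrier (tensor_algebra D)" by (auto simp: kernel_ideal_def)
    show "kernel_ideal \<noteq> {}"
      using im1_0 by (auto simp: kernel_ideal_def lin_zero[OF lin_canonical] lin_zero[OF lin_split_last] intro!: exI[of _ 0])
    fix a b assume ab: "a \<in> kernel_ideal"
    have "\<ominus>\<^bsub>tensor_algebra D\<^esub> a = - a"
      by (rule minus_equality) (use ab in \<open>auto simp: kernel_ideal_def coord_space_neg\<close>)
    then show "\<ominus>\<^bsub>tensor_algebra D\<^esub> a \<in> kernel_ideal"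
      using ab vs.subspace_neg[OF subspace_im1]
      by (simp add: kernel_ideal_def coord_space_neg lin_minus[OF lin_canonical] lin_minus[OF lin_split_last])
    assume "b \<in> kernel_ideal"
    then show "a \<oplus>\<^bsub>tensor_algebra D\<^esub> b \<in> kernel_ideal"
      using ab by (simp add: kernel_ideal_def coord_space_add lin_add[OF lin_canonical] lin_add[OF lin_split_last] im1_add)
  qed
next
  fix f g assume f: "f \<in> kernel_ideal" and "g \<in> carrier (tensor_algebra D :: ('i list \<Rightarrow>\<^sub>0 'k) ring)"
  then have g: "g \<in> coord_space (lists D)" by simp
  have f': "f \<in> coord_space (lists D)" "\<pi> f = 0" "split_last f \<in> im1"
    using f by (auto simp: kernel_ideal_def)
  show "g \<otimes>\<^bsub>tensor_algebra D\<^esub> f \<in> kernel_ideal"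
    using f' g Nil_notin_keys_kernel[OF f'(1,2)]
    by (simp add: kernel_ideal_def conv_in_coord_space canonical_conv gprod_simps split_last_conv_left im1_act)
  \<comment> \<open>By linearity \<open>g\<close> may be taken to be a word. The empty word gives
    back \<open>f\<close>; any other word gives 0, because \<open>f\<close> is zero in C.\<close>
  have "split_last (conv f g) \<in> im1"
  proof (rule lin_in_subspace[OF lin_comp[OF lin_split_last lin_conv_right] subspace_im1])
    fix w
    show "split_last (conv f (bas w)) \<in> im1"
    proof (cases w rule: rev_cases)
      case Nil
      then show ?thesis using f' by simp
    next
      case (snoc v a)
      then show ?thesis using f' im1_0 by (simp add: split_last_conv_snoc gprod_simps lin_tens_simps)
    qed
  qed
  then show "f \<otimes>\<^bsub>tensor_algebra D\<^esub> g \<in> kernel_ideal"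
    using f' g by (simp add: kernel_ideal_def conv_in_coord_space canonical_conv gprod_simps)
qed

lemma relations_subset_kernel_ideal: "canonical_kernel C \<inter> hom_comp length 2 \<subseteq> kernel_ideal"
proof -
  have "vs.subspace kernel_ideal"
    unfolding vs.subspace_def kernel_ideal_def
    by (auto simp: coord_space_add lin_add[OF lin_canonical] lin_add[OF lin_split_last] im1_add
      lin_zero[OF lin_canonical] lin_zero[OF lin_split_last] im1_0 im1_smul
      lin_smul[OF lin_canonical] lin_smul[OF lin_split_last] vs.subspace_scale[OF subspace_coord_space])
  then have "vs.span (z ` S2) \<subseteq> kernel_ideal"
    by (intro vs.span_minimal) (auto simp: kernel_ideal_def z_in split_last_z_in_im1 simp del: One_nat_def)
  then show ?thesis by (simp add: span_z)
qed

text \<open>Here quadraticity enters: the ideal of relations is the smallest ideal containing the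
  quadratic ones.\<close>

lemma canonical_kernel_subset_kernel_ideal: "canonical_kernel C \<subseteq> kernel_ideal"
proof -
  interpret ring "tensor_degree_one C"
    unfolding tensor_degree_one_def by (rule ring_tensor_algebra)
  have "Idl\<^bsub>tensor_degree_one C\<^esub> (canonical_kernel C \<inter> hom_comp length 2) \<subseteq> kernel_ideal"
    by (rule genideal_minimal[OF ideal_kernel_ideal relations_subset_kernel_ideal])
  then show ?thesis
    using quadratic by (simp add: quadratic_def)
qed

text \<open>Lifting the C-factor of each basis vector to the tensor algebra and appending the letter
  turns \<open>p\<close> into a tensor \<open>f\<close> with \<open>split_last f = p\<close> and
  image \<open>\<mu> p = 0\<close> in C. So the cycle \<open>p\<close> comes from a relation, and
  relations give boundaries.\<close>

lemma exact_middle: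
  assumes "p \<in> free_module S1" "\<mu> p = 0"
  shows "p \<in> im1"
proof -
  define g where "g i = (SOME f. f \<in> coord_space (lists D) \<and> \<pi> f = bas i)" for i
  have g: "g i \<in> coord_space (lists D)" "\<pi> (g i) = bas i" for i
    using canonical_surj[of "bas i"] someI_ex[of "\<lambda>f. f \<in> coord_space (lists D) \<and> \<pi> f = bas i"]
    unfolding g_def by blast+
  define f where "f = lin_ext (\<lambda>(i, s). conv (g i) (bas [\<kappa> s])) p"
  have keys: "snd x \<in> S1" if "x \<in> Poly_Mapping.keys p" for x
    using assms(1) that by (auto simp: free_module_def)
  have "f \<in> coord_space (lists D)"
    unfolding f_def
  proof (rule lin_ext_in_subspace[OF subspace_coord_space])
    fix x assume "x \<in> Poly_Mapping.keys p"
    then show "(case x of (i, s) \<Rightarrow> conv (g i) (bas [\<kappa> s])) \<in> coord_space (lists D)"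
      using keys[of x] by (auto intro!: conv_in_coord_space g simp: \<kappa>_deg simp del: One_nat_def split: prod.split)
  qed
  moreover have "\<pi> f = \<mu> p"
    unfolding f_def lin_lin_ext_apply[OF lin_canonical] \<mu>_def
    by (rule lin_ext_cong) (auto simp: canonical_conv g canonical_single)
  moreover have "split_last f = p"
  proof -
    have "split_last f = lin_ext (\<lambda>(i, s). bas (i, s)) p"
      unfolding f_def lin_lin_ext_apply[OF lin_split_last]
    proof (rule lin_ext_cong[OF _ refl])
      fix x assume "x \<in> Poly_Mapping.keys p"
      then show "split_last (case x of (i, s) \<Rightarrow> conv (g i) (bas [\<kappa> s])) = (case x of (i, s) \<Rightarrow> bas (i, s))"
        using keys[of x] split_last_conv_snoc[of "g (fst x)" "[]" "\<kappa> (snd x)"]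
        by (cases x) (simp add: g \<iota>_\<kappa>)
    qed
    then show ?thesis by simp
  qed
  ultimately have "f \<in> kernel_ideal" "split_last f = p"
    using canonical_kernel_subset_kernel_ideal assms(2) by (auto simp: canonical_kernel_eq)
  then show ?thesis by (auto simp: kernel_ideal_def)
qed

section \<open>Exactness at C, and degrees of the differentials\<close>

lemma d1_in: "p \<in> free_module S2 \<Longrightarrow> d1 p \<in> free_module S1"
  unfolding free_module_eq
proof (rule lin_in_subspace[OF lin_d1 subspace_coord_space])
  fix x assume "p \<in> coord_space (UNIV \<times> S2)" "x \<in> Poly_Mapping.keys p"
  then have "snd x \<in> S2" by (auto simp: coord_space_def)
  then show "d1 (bas x) \<in> coord_space (UNIV \<times> S1)"
    by (cases x) (simp add: d1_tens split_last_in z_in act_in_free_module del: One_nat_def flip: tens_bas free_module_eq)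
qed

lemma \<mu>_d1:
  assumes "p \<in> free_module S2"
  shows "\<mu> (d1 p) = 0"
proof (rule lin_eq_on_keys[of "\<lambda>p. \<mu> (d1 p)" "\<lambda>_. 0"])
  fix x assume "x \<in> Poly_Mapping.keys p"
  then have "snd x \<in> S2" using assms by (auto simp: free_module_def)
  then show "\<mu> (d1 (bas x)) = 0"
    by (cases x)
       (simp add: d1_tens \<mu>_act \<mu>_split_last z_in Nil_notin_keys_kernel gprod_simps del: One_nat_def flip: tens_bas)
qed (auto intro: lin_comp lin_\<mu> lin_d1)

lemma im1_eq: "im1 = {p \<in> free_module S1. \<mu> p = 0}"
  using exact_middle d1_in \<mu>_d1 by (auto simp: im1_def)

lemma \<mu>_hom_comp: "s \<in> S1 \<Longrightarrow> \<mu> (bas (i, s)) \<in> hom_comp deg (deg i + 1)"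
  using gprod_hom_comp[OF bas_hom_comp[of i] bas_hom_comp[of "\<kappa> s"]] by (simp add: \<mu>_def \<kappa>_deg)

text \<open>Elements of positive degree lift to tensors without constant term, from which a last
  letter can be split off.\<close>

lemma \<mu>_image: "\<mu> ` free_module S1 = augmentation_ideal C"
proof (intro subset_antisym subsetI)
  fix y assume "y \<in> \<mu> ` free_module S1"
  then obtain p where p: "p \<in> free_module S1" "y = \<mu> p" by blast
  have "\<mu> p \<in> augmentation_ideal C"
    unfolding augmentation_ideal_eq
  proof (rule lin_in_subspace[OF lin_\<mu> subspace_coord_space])
    fix x assume "x \<in> Poly_Mapping.keys p"
    then have "snd x \<in> S1" using p by (auto simp: free_module_def)
    then show "\<mu> (bas x) \<in> coord_space {i. deg i > 0}"
      using \<mu>_hom_comp[of "snd x" "fst x"] by (auto simp: hom_comp_eq_coord_space elim!: coord_space_mono)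
  qed
  then show "y \<in> augmentation_ideal C" using p by simp
next
  fix y assume y: "y \<in> augmentation_ideal C"
  obtain f where f: "f \<in> coord_space (lists D)" "\<pi> f = y" by (rule canonical_surj)
  then have "\<mu> (split_last f) = y"
    using \<mu>_split_last Nil_notin_keys y by simp
  then show "y \<in> \<mu> ` free_module S1" using split_last_in[OF f(1)] by blast
qed

lemma act_hom_comp:
  assumes "p \<in> free_comp C S n m"
  shows "act C (bas i) p \<in> free_comp C S n (deg i + m)"
  unfolding free_comp_eq
proof (rule lin_in_subspace[OF lin_act subspace_coord_space])
  fix x assume "x \<in> Poly_Mapping.keys p"
  then have x: "snd x \<in> S" "deg (fst x) + n = m" using assms by (auto simp: free_comp_eq coord_space_def)
  show "act C (bas i) (bas x) \<in> coord_space {(j, s). s \<in> S \<and> deg j + n = deg i + m}"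
    using x gprod_hom_comp[OF bas_hom_comp[of i] bas_hom_comp[of "fst x"]]
    by (cases x) (auto simp: act_tens hom_comp_eq_coord_space simp flip: tens_bas
        intro!: tens_in_coord_space[of _ "{j. deg j = deg i + deg (fst x)}" _ S])
qed

text \<open>Relations consist of words of length two, so one letter remains in C after splitting.
  This makes the differential out of C \<otimes> R linear: generators in degree 2 go to C_1 times
  generators in degree 1.\<close>

lemma split_last_z_hom: "s \<in> S2 \<Longrightarrow> split_last (z s) \<in> free_comp C S1 1 2"
  unfolding free_comp_eq
proof (rule lin_in_subspace[OF lin_split_last subspace_coord_space])
  fix w assume s: "s \<in> S2" and "w \<in> Poly_Mapping.keys (z s)"
  then have w: "w \<in> lists D" "length w = 2"
    using z_in[OF s] by (auto simp: hom_comp_def coord_space_def)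
  then obtain a b where ab: "w = [a, b]" "deg a = 1" "deg b = 1"
    by (auto simp: numeral_2_eq_2 length_Suc_conv)
  then show "split_last (bas w) \<in> coord_space {(i, s). s \<in> S1 \<and> deg i + 1 = 2}"
    using split_last_snoc[of "[a]" b] by (simp add: canonical_single \<iota>_in)
qed

lemma d1_hom:
  assumes "s \<in> S2"
  shows "d1 (bas (i, s)) \<in> free_comp C S1 1 (deg i + 2)"
  using act_hom_comp[OF split_last_z_hom[OF assms]] by (simp add: d1_def)


subsection \<open>Injectivity by counting dimensions\<close>

lemma d1_hproj:
  assumes "p \<in> free_module S2"
  shows "d1 (hproj (tdeg deg (\<lambda>_. 2)) n p) = hproj (tdeg deg (\<lambda>_. 1)) n (d1 p)"
proof (rule hproj_commute[OF lin_d1])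
  fix x assume "x \<in> Poly_Mapping.keys p"
  then have "snd x \<in> S2" using assms by (auto simp: free_module_def)
  then show "d1 (bas x) \<in> hom_comp (tdeg deg (\<lambda>_. 1)) (tdeg deg (\<lambda>_. 2) x)"
    using d1_hom[of "snd x" "fst x"] by (cases x) (simp add: free_comp_def tdeg_def)
qed

lemma \<mu>_hproj:
  assumes "p \<in> free_module S1"
  shows "\<mu> (hproj (tdeg deg (\<lambda>_. 1)) n p) = hproj deg n (\<mu> p)"
proof (rule hproj_commute[OF lin_\<mu>])
  fix x assume "x \<in> Poly_Mapping.keys p"
  then have "snd x \<in> S1" using assms by (auto simp: free_module_def)
  then show "\<mu> (bas x) \<in> hom_comp deg (tdeg deg (\<lambda>_. 1) x)"
    using \<mu>_hom_comp[of "snd x" "fst x"] by (cases x) (simp add: tdeg_def)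
qed

text \<open>In degree m + 2 the sequence C_m \<otimes> R \<rightarrow> C_(m+1) \<otimes> C_1
  \<rightarrow> C_(m+2) \<rightarrow> 0 is exact and finite dimensional. Rank-nullity, applied to
  both maps, gives the kernel of the first map dimension |S2| dim C_m - |S1| dim C_(m+1) + dim
  C_(m+2), which is 0 by \<open>count\<close>.\<close>

lemma d1_inj:
  assumes fin: "finite S1" "finite S2"
    and count: "\<And>m. card {i. deg i = m + 2} + card S2 * card {i. deg i = m}
                  = card S1 * card {i. deg i = m + 1}"
    and p: "p \<in> free_module S2" "d1 p = 0"
  shows "p = 0"
proof (rule hproj_eq_0_imp)
  fix n
  define q where "q = hproj (tdeg deg (\<lambda>_. 2)) n p"
  let ?F2 = "\<lambda>m. {i. deg i = m} \<times> S2" and ?F1 = "\<lambda>m. {i. deg i = m + 1} \<times> S1"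
  have finF: "finite (?F2 m)" "finite (?F1 m)" for m
    using fin finite_deg by auto
  have "d1 q = hproj (tdeg deg (\<lambda>_. 1)) n (d1 p)"
    unfolding q_def by (rule d1_hproj[OF p(1)])
  then have dq: "d1 q = 0" using p by (simp add: lin_zero)
  have q: "q \<in> coord_space {x \<in> UNIV \<times> S2. tdeg deg (\<lambda>_. 2) x = n}"
    unfolding q_def by (rule hproj_in_coord_space) (use p in \<open>simp add: free_module_eq\<close>)
  \<comment> \<open>The generators sit in degree 2, so nothing lives in degrees 0 and 1, and the
    subtraction n - 2 is safe afterwards.\<close>
  show "q = 0"
  proof (cases "n \<ge> 2")
    case False
    then have "{x \<in> UNIV \<times> S2. tdeg deg (\<lambda>_. 2) x = n} = {}" by (auto simp: tdeg_def)
    from q[unfolded this] show ?thesis by (simp add: coord_space_def)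
  next
    case True
    then obtain m where n: "n = m + 2" by (metis add.commute le_Suc_ex)
    have q': "q \<in> coord_space (?F2 m)"
      by (rule coord_space_mono[OF q]) (auto simp: tdeg_def n)
    let ?V2 = "coord_space (?F2 m) :: ('i \<times> nat \<Rightarrow>\<^sub>0 'k) set"
    let ?V1 = "coord_space (?F1 m) :: ('i \<times> nat \<Rightarrow>\<^sub>0 'k) set"
    let ?V0 = "coord_space {i. deg i = m + 2} :: ('i \<Rightarrow>\<^sub>0 'k) set"
    have im2: "d1 ` ?V2 = {x \<in> ?V1. \<mu> x = 0}"
    proof (intro subset_antisym subsetI)
      fix y assume "y \<in> d1 ` ?V2"
      then obtain x where x: "x \<in> ?V2" "y = d1 x" by blast
      have "d1 x \<in> ?V1"
      proof (rule lin_in_subspace[OF lin_d1 subspace_coord_space])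
        fix t assume "t \<in> Poly_Mapping.keys x"
        then have "snd t \<in> S2" "deg (fst t) = m" using x by (auto simp: coord_space_def)
        then show "d1 (bas t) \<in> ?V1"
          using d1_hom[of "snd t" "fst t"] by (cases t) (auto simp: free_comp_eq elim!: coord_space_mono)
      qed
      moreover have "x \<in> free_module S2"
        using x(1) unfolding free_module_eq by (rule coord_space_mono) auto
      ultimately show "y \<in> {x \<in> ?V1. \<mu> x = 0}" using x \<mu>_d1 by auto
    next
      fix y assume y: "y \<in> {x \<in> ?V1. \<mu> x = 0}"
      have "y \<in> free_module S1"
        using y unfolding free_module_eq by (auto elim!: coord_space_mono)
      then obtain x where x: "x \<in> free_module S2" "y = d1 x"
        using exact_middle[of y] y by (auto simp: im1_def)
      \<comment> \<open>Exactness was proved without regard to degrees, so the preimage need not be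
        homogeneous. Its component of degree \<open>n\<close> is again a preimage, since
        \<open>d1\<close> commutes with the projections.\<close>
      let ?x = "hproj (tdeg deg (\<lambda>_. 2)) n x"
      have "d1 ?x = hproj (tdeg deg (\<lambda>_. 1)) n (d1 x)"
        by (rule d1_hproj[OF x(1)])
      also have "\<dots> = y"
      proof -
        have "y \<in> hom_comp (tdeg deg (\<lambda>_. 1)) n"
          using y by (auto simp: hom_comp_eq_coord_space tdeg_def n elim!: coord_space_mono)
        then show ?thesis using x hproj_hom_comp[of y _ n n] by (simp del: One_nat_def)
      qed
      finally have "d1 ?x = y" .
      moreover have "?x \<in> ?V2"
      proof (rule coord_space_mono)
        show "?x \<in> coord_space {t \<in> UNIV \<times> S2. tdeg deg (\<lambda>_. 2) t = n}"
          by (rule hproj_in_coord_space) (use x in \<open>simp add: free_module_eq\<close>)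
      qed (auto simp: tdeg_def n)
      ultimately show "y \<in> d1 ` ?V2" by blast
    qed
    have im1: "\<mu> ` ?V1 = ?V0"
    proof (intro subset_antisym subsetI)
      fix y assume "y \<in> \<mu> ` ?V1"
      then obtain x where x: "x \<in> ?V1" "y = \<mu> x" by blast
      have "\<mu> x \<in> ?V0"
      proof (rule lin_in_subspace[OF lin_\<mu> subspace_coord_space])
        fix t assume "t \<in> Poly_Mapping.keys x"
        then have "snd t \<in> S1" "deg (fst t) = m + 1" using x by (auto simp: coord_space_def)
        then show "\<mu> (bas t) \<in> ?V0"
          using \<mu>_hom_comp[of "snd t" "fst t"] by (cases t) (simp add: hom_comp_eq_coord_space)
      qed
      then show "y \<in> ?V0" using x by simp
    next
      fix y assume y: "y \<in> ?V0"
      then have "y \<in> augmentation_ideal C"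
        unfolding augmentation_ideal_eq by (rule coord_space_mono) auto
      then obtain x where x: "x \<in> free_module S1" "y = \<mu> x"
        unfolding \<mu>_image[symmetric] by blast
      let ?x = "hproj (tdeg deg (\<lambda>_. 1)) n x"
      have "\<mu> ?x = hproj deg n (\<mu> x)"
        by (rule \<mu>_hproj[OF x(1)])
      also have "\<dots> = y"
        using y x hproj_hom_comp[of y deg n n] by (simp add: hom_comp_eq_coord_space n)
      finally have "\<mu> ?x = y" .
      moreover have "?x \<in> ?V1"
      proof (rule coord_space_mono)
        show "?x \<in> coord_space {t \<in> UNIV \<times> S1. tdeg deg (\<lambda>_. 1) t = n}"
          by (rule hproj_in_coord_space) (use x in \<open>simp add: free_module_eq\<close>)
      qed (auto simp: tdeg_def n)
      ultimately show "y \<in> \<mu> ` ?V1" by blast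
    qed
    have "vs.dim ?V1 = vs.dim (d1 ` ?V2) + vs.dim ?V0"
      unfolding im2 im1[symmetric]
      by (rule rank_nullity[OF lin_\<mu> subspace_coord_space subset_refl finF(2)])
    moreover have "vs.dim ?V2 = vs.dim {x \<in> ?V2. d1 x = 0} + vs.dim (d1 ` ?V2)"
      by (rule rank_nullity[OF lin_d1 subspace_coord_space subset_refl finF(1)])
    ultimately have "vs.dim {x \<in> ?V2. d1 x = 0} = 0"
      using count[of m] by (simp add: dim_coord_space card_cartesian_product mult.commute)
    then have "{x \<in> ?V2. d1 x = 0} \<subseteq> {0}"
      by (intro dim_zero_imp_trivial[OF _ finF(1)]) auto
    then show ?thesis using q' dq by auto
  qed
qed

text \<open>The resolution is 0 \<rightarrow> C \<otimes> R \<rightarrow> C \<otimes> C_1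
  \<rightarrow> C \<rightarrow> K \<rightarrow> 0, continued by zero modules. The recursion on
  dimensions is used for the injectivity on the left.\<close>

lemma koszul_if_hilbert_recursion:
  assumes fin: "finite S1" "finite S2"
    and count: "\<And>m. card {i. deg i = m + 2} + card S2 * card {i. deg i = m}
                  = card S1 * card {i. deg i = m + 1}"
  shows "koszul C"
proof -
  interpret I: ideal "augmentation_ideal C" "galg_ring C" by (rule ideal_augmentation)
  \<comment> \<open>The single generator 0 in position 0 makes the first module a copy of C;
    \<open>\<theta>\<close> below identifies the two, with inverse given by tensoring with
    \<open>bas 0\<close>.\<close>
  define S :: "nat \<Rightarrow> nat set" where
    "S n = (if n = 0 then {0} else if n = 1 then S1 else if n = 2 then S2 else {})" for n
  define \<theta> :: "('i \<times> nat \<Rightarrow>\<^sub>0 'k) \<Rightarrow> ('i \<Rightarrow>\<^sub>0 'k)" where "\<theta> = lin_ext (\<lambda>(i, s). bas i)"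
  define \<epsilon> where "\<epsilon> p = augmentation_ideal C +>\<^bsub>galg_ring C\<^esub> \<theta> p" for p
  define d :: "nat \<Rightarrow> ('i \<times> nat \<Rightarrow>\<^sub>0 'k) \<Rightarrow> ('i \<times> nat \<Rightarrow>\<^sub>0 'k)" where
    "d n = (if n = 0 then (\<lambda>p. tens (\<mu> p) (bas 0)) else if n = 1 then d1 else (\<lambda>_. 0))" for n
  have S_simps: "S 0 = {0}" "S 1 = S1" "S (Suc 0) = S1" "S (Suc (Suc 0)) = S2" "S (Suc (Suc (Suc n))) = {}" for n
    by (auto simp: S_def)
  have d_simps: "d 0 = (\<lambda>p. tens (\<mu> p) (bas 0))" "d (Suc 0) = d1" "d (Suc (Suc n)) = (\<lambda>_. 0)" for n
    by (auto simp: d_def)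
  have lin_\<theta>: "lin \<theta>" by (simp add: \<theta>_def)
  have \<theta>_tens: "\<theta> (tens x (bas s)) = x" for x s
    by (rule lin_eqI[of "\<lambda>x. \<theta> (tens x (bas s))" "\<lambda>x. x"])
       (auto intro: lin_comp[OF lin_\<theta> lin_tens_left], simp add: \<theta>_def)
  have tens_\<theta>: "tens (\<theta> p) (bas 0) = p" if "p \<in> free_module {0}" for p
  proof (rule lin_eq_on_keys[of "\<lambda>p. tens (\<theta> p) (bas 0)" "\<lambda>p. p"])
    fix x assume "x \<in> Poly_Mapping.keys p"
    then have "snd x = 0" using that by (auto simp: free_module_def)
    then show "tens (\<theta> (bas x)) (bas 0) = bas x" by (cases x) (simp add: \<theta>_def)
  qed (auto intro: lin_comp[OF lin_tens_left lin_\<theta>])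
  have \<theta>_act: "\<theta> (act C c p) = c \<star> \<theta> p" for c p
  proof (rule lin_eqI[of "\<lambda>p. \<theta> (act C c p)" "\<lambda>p. c \<star> \<theta> p"])
    fix x :: "'i \<times> nat" show "\<theta> (act C c (bas x)) = c \<star> \<theta> (bas x)"
      by (cases x) (simp add: act_tens \<theta>_tens flip: tens_bas)
  qed (auto intro: lin_comp lin_act lin_right lin_\<theta>)
  have lin_d: "lin (d n)" for n
    by (auto simp: d_def lin_d1 intro: lin_comp[OF lin_tens_left lin_\<mu>])
  have d_act: "d n (act C c p) = act C c (d n p)" for n c p
    by (auto simp: d_def \<mu>_act act_tens d1_act lin_zero[OF lin_act])
  have zero_iff: "\<epsilon> p = \<zero>\<^bsub>trivial_module C\<^esub> \<longleftrightarrow> \<theta> p \<in> augmentation_ideal C" for p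
  proof
    assume "\<epsilon> p = \<zero>\<^bsub>trivial_module C\<^esub>"
    then show "\<theta> p \<in> augmentation_ideal C"
      using I.a_rcos_self[of "\<theta> p"] by (simp add: \<epsilon>_def trivial_module_def FactRing_def)
  next
    assume "\<theta> p \<in> augmentation_ideal C"
    then show "\<epsilon> p = \<zero>\<^bsub>trivial_module C\<^esub>"
      using I.a_rcos_const[of "\<theta> p"] by (simp add: \<epsilon>_def trivial_module_def FactRing_def)
  qed
  have exact0: "d 0 ` free_module S1 = {p \<in> free_module {0}. \<theta> p \<in> augmentation_ideal C}"
  proof (intro subset_antisym subsetI)
    fix q assume "q \<in> d 0 ` free_module S1"
    then show "q \<in> {p \<in> free_module {0}. \<theta> p \<in> augmentation_ideal C}"
      using \<mu>_image by (auto simp: d_simps \<theta>_tens tens_in_free_module)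
  next
    fix q assume q: "q \<in> {p \<in> free_module {0}. \<theta> p \<in> augmentation_ideal C}"
    then obtain p where "p \<in> free_module S1" "\<theta> q = \<mu> p"
      using \<mu>_image by auto
    then show "q \<in> d 0 ` free_module S1"
      using q tens_\<theta>[of q] by (auto simp: d_simps intro!: image_eqI[of _ _ p])
  qed
  have tens_0: "tens x (bas (0::nat)) = 0 \<longleftrightarrow> x = 0" for x :: "'i \<Rightarrow>\<^sub>0 'k"
    using \<theta>_tens[of x 0] by (auto simp: lin_zero[OF lin_\<theta>] lin_tens_simps)
  have free_empty: "free_module {} = {0 :: 'i \<times> nat \<Rightarrow>\<^sub>0 'k}"
    by (auto simp: free_module_def)
  have exact: "d (Suc n) ` free_module (S (Suc (Suc n))) = {p \<in> free_module (S (Suc n)). d n p = 0}" for n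
  proof -
    \<comment> \<open>The cases are exactness at C \<otimes> C_1, injectivity on C \<otimes> R, and
      the zero modules beyond.\<close>
    consider "n = 0" | "n = 1" | m where "n = Suc (Suc m)"
      by (metis One_nat_def not0_implies_Suc)
    then show ?thesis
    proof cases
      case 1
      then show ?thesis using im1_eq by (simp add: S_simps d_simps tens_0 im1_def)
    next
      case 2
      have "{p \<in> free_module S2. d1 p = 0} = {0}"
        using d1_inj[OF fin count] by (auto simp: lin_zero[OF lin_d1] free_module_eq)
      then show ?thesis using 2 by (simp add: S_simps d_simps free_empty)
    next
      case 3
      then show ?thesis by (auto simp: S_simps d_simps free_empty)
    qed
  qed
  have d_deg: "d n ` free_comp C (S (Suc n)) (Suc n) m \<subseteq> free_comp C (S n) n m" for n m
  proof
    fix y assume "y \<in> d n ` free_comp C (S (Suc n)) (Suc n) m"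
    then obtain p where p: "p \<in> free_comp C (S (Suc n)) (Suc n) m" "y = d n p" by blast
    have "d n p \<in> free_comp C (S n) n m"
      unfolding free_comp_eq
    proof (rule lin_in_subspace[OF lin_d subspace_coord_space])
      fix x assume "x \<in> Poly_Mapping.keys p"
      then have x: "snd x \<in> S (Suc n)" "deg (fst x) + Suc n = m"
        using p by (auto simp: free_comp_eq coord_space_def)
      consider "n = 0" | "n = 1" | l where "n = Suc (Suc l)"
        by (metis One_nat_def not0_implies_Suc)
      then show "d n (bas x) \<in> coord_space {(i, s). s \<in> S n \<and> deg i + n = m}"
      proof cases
        case 1
        then have "\<mu> (bas x) \<in> coord_space {i. deg i = m}"
          using \<mu>_hom_comp[of "snd x" "fst x"] x by (simp add: hom_comp_eq_coord_space S_simps)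
        then show ?thesis
          using 1 by (auto simp: d_simps S_simps intro!: tens_in_coord_space[of _ "{i. deg i = m}" _ "{0}"])
      next
        case 2
        then show ?thesis
          using d1_hom[of "snd x" "fst x"] x by (auto simp: d_simps S_simps free_comp_eq elim!: coord_space_mono)
      qed (use x in \<open>simp add: S_simps\<close>)
    qed
    then show "y \<in> free_comp C (S n) n m" using p by simp
  qed
  have "linear_free_resolution C S \<epsilon> d"
    unfolding linear_free_resolution_def
  proof (intro conjI ballI allI impI)
    fix p q
    show "\<epsilon> (p + q) = \<epsilon> p \<oplus>\<^bsub>trivial_module C\<^esub> \<epsilon> q"
      using I.a_rcos_sum[of "\<theta> p" "\<theta> q"]
      by (simp add: \<epsilon>_def trivial_module_def FactRing_def lin_add[OF lin_\<theta>])
  next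
    fix c p
    show "\<epsilon> (act C c p) = (augmentation_ideal C +>\<^bsub>galg_ring C\<^esub> c) \<otimes>\<^bsub>trivial_module C\<^esub> \<epsilon> p"
      using I.rcoset_mult_add[of c "\<theta> p"]
      by (simp add: \<epsilon>_def trivial_module_def FactRing_def \<theta>_act)
  next
    fix m :: nat and p :: "'i \<times> nat \<Rightarrow>\<^sub>0 'k"
    assume m: "0 < m" and p: "p \<in> free_comp C (S 0) 0 m"
    have "\<theta> p \<in> augmentation_ideal C"
      unfolding augmentation_ideal_eq
    proof (rule lin_in_subspace[OF lin_\<theta> subspace_coord_space])
      fix x assume "x \<in> Poly_Mapping.keys p"
      then show "\<theta> (bas x) \<in> coord_space {i. deg i > 0}"
        using m p by (cases x) (auto simp: \<theta>_def free_comp_eq coord_space_def)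
    qed
    then show "\<epsilon> p = \<zero>\<^bsub>trivial_module C\<^esub>" by (simp add: zero_iff)
  next
    have "\<epsilon> (tens x (bas 0)) = augmentation_ideal C +>\<^bsub>galg_ring C\<^esub> x" for x
      by (simp add: \<epsilon>_def \<theta>_tens)
    moreover have "tens x (bas 0) \<in> free_module (S 0)" for x :: "'i \<Rightarrow>\<^sub>0 'k"
      by (simp add: S_simps tens_in_free_module)
    ultimately show "\<epsilon> ` free_module (S 0) = carrier (trivial_module C)"
      by (auto simp: trivial_module_def FactRing_def A_RCOSETS_def' \<epsilon>_def)
  next
    show "d 0 ` free_module (S 1) = {p \<in> free_module (S 0). \<epsilon> p = \<zero>\<^bsub>trivial_module C\<^esub>}"
      using exact0 by (simp add: S_simps zero_iff)
  next
    fix n m show "d n ` free_comp C (S (Suc n)) (Suc n) m \<subseteq> free_comp C (S n) n m" by (rule d_deg)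
  qed (rule lin_add[OF lin_d] d_act exact)+
  then show ?thesis by (auto simp: koszul_def)
qed

end


text \<open>The recursion itself forces \<open>r\<close> to be the dimension of R: for m = 0, as C_0
  is a line, it says that r = (dim C_1)^2 - dim C_2, and C_1 \<otimes> C_1 maps onto C_2 with kernel
  R. Hence a basis of R can be enumerated by \<open>{0..<r}\<close>.\<close>

theorem koszul_if_quadratic_and_hilbert_recursion:
  fixes C :: "('i, 'k::field) galg"
  assumes "graded_algebra C" and quad: "quadratic C"
    and count: "\<And>m. card {i. gdeg C i = m + 2} + r * card {i. gdeg C i = m}
                  = card {i. gdeg C i = 1} * card {i. gdeg C i = m + 1}"
  shows "koszul C"
proof -
  interpret graded_alg C by unfold_locales fact
  let ?N = "card D"
  let ?R = "canonical_kernel C \<inter> hom_comp length 2"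
  let ?W2 = "{w. set w \<subseteq> D \<and> length w = 2}"
  let ?V = "coord_space ?W2 :: ('i list \<Rightarrow>\<^sub>0 'k) set"
  have finW: "finite ?W2"
    by (rule finite_lists_length_eq[OF finite_deg])
  have V: "?V = coord_space (lists D) \<inter> hom_comp length 2"
    by (auto simp: coord_space_def hom_comp_def lists_eq_set)
  have R: "?R = {f \<in> ?V. \<pi> f = 0}"
    unfolding V by (auto simp: canonical_kernel_def tensor_degree_one_def)
  have subR: "vs.subspace ?R"
    unfolding R using subspace_coord_space[of ?W2]
    by (auto simp: vs.subspace_def lin_add[OF lin_canonical] lin_smul[OF lin_canonical] lin_zero[OF lin_canonical])
  \<comment> \<open>Surjectivity of the canonical map is known only as a whole. To get it in degree
    two, a preimage is replaced by its part of length two.\<close>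
  have hom: "\<pi> (hproj length 2 f) = hproj deg 2 (\<pi> f)" if "f \<in> coord_space (lists D)" for f
    by (rule hproj_commute[OF lin_canonical], rule canonical_hom_comp, use that in \<open>unfold coord_space_def, blast\<close>)
  have "\<pi> ` ?V = coord_space {i. deg i = 2}"
  proof (intro subset_antisym subsetI)
    fix y assume "y \<in> \<pi> ` ?V"
    then obtain f where f: "f \<in> ?V" "y = \<pi> f" by blast
    have "\<pi> f = hproj deg 2 (\<pi> f)"
      using hom[of f] f(1) hproj_hom_comp[of f length 2 2] unfolding V by simp
    then show "y \<in> coord_space {i. deg i = 2}"
      using hproj_in_coord_space[of "\<pi> f" UNIV deg 2] f by (simp add: coord_space_UNIV)
  next
    fix y :: "'i \<Rightarrow>\<^sub>0 'k" assume y: "y \<in> coord_space {i. deg i = 2}"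
    have "y \<in> \<pi> ` coord_space (lists D)"
      using quad by (simp add: quadratic_def tensor_degree_one_def)
    then obtain f where f: "f \<in> coord_space (lists D)" "y = \<pi> f" by blast
    have "\<pi> (hproj length 2 f) = y"
      using hom[OF f(1)] f(2) y hproj_hom_comp[of y deg 2 2] by (simp add: hom_comp_eq_coord_space)
    moreover have "hproj length 2 f \<in> ?V"
      by (rule coord_space_mono[OF hproj_in_coord_space[OF f(1)]]) auto
    ultimately show "y \<in> \<pi> ` ?V" by blast
  qed
  then have "vs.dim ?V = vs.dim ?R + card {i. deg i = 2}"
    using rank_nullity[OF lin_canonical subspace_coord_space subset_refl finW]
    by (simp add: R dim_coord_space)
  then have "?N ^ 2 = vs.dim ?R + card {i. deg i = 2}"
    using card_lists_length_eq[OF finite_deg[of 1], of 2] by (simp add: dim_coord_space)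
  then have dimR: "vs.dim ?R = r"
    using count[of 0] deg_0_eq by (simp add: power2_eq_square numeral_2_eq_2)
  obtain W where W: "W \<subseteq> ?R" "vs.independent W" "?R \<subseteq> vs.span W" "card W = vs.dim ?R"
    using vs.basis_exists by blast
  have "finite W" using independent_finite_card[of W ?W2] W finW by (auto simp: R)
  then obtain z where z: "bij_betw z {0..<r} W"
    using ex_bij_betw_nat_finite[of W] W dimR by auto
  obtain \<kappa> where \<kappa>: "bij_betw \<kappa> {0..<?N} D"
    using ex_bij_betw_nat_finite[OF finite_deg] by blast
  interpret quadratic_presentation C "{0..<?N}" "{0..<r}" \<kappa> z
  proof
    have "z ` {0..<r} = W" using z by (simp add: bij_betw_def)
    then show "vs.span (z ` {0..<r}) = ?R"
      using vs.span_subspace[OF W(1,3) subR] by simp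
  qed (fact quad \<kappa>)+
  show ?thesis
    by (rule koszul_if_hilbert_recursion) (use count in auto)
qed

section \<open>Twisted tensor products\<close>

lemma lin_case_prod: "(\<And>u v. lin (\<lambda>x. G x u v)) \<Longrightarrow> lin (\<lambda>x. case i of (u, v) \<Rightarrow> G x u v)"
  by (cases i) simp

lemmas lin_tensI = lin_comp[OF lin_tens_left] lin_comp[OF lin_tens_right] lin_comp[OF lin_lin_ext]
  lin_comp[OF lin_tmap] lin_ext_fun_lin lin_case_prod

lemma lin_mid: "lin (mid t)"
  unfolding mid_def comp_def by (intro lin_tensI lin_id)

lemma mid_bas:
  fixes t :: "('q \<times> 'r \<Rightarrow>\<^sub>0 'k::field) \<Rightarrow> ('u \<times> 'v \<Rightarrow>\<^sub>0 'k)"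
  shows "mid t (bas ((p, q), (r, s))) = lin_ext (\<lambda>(u, v). bas ((p, u), (v, s))) (t (bas (q, r)))"
proof -
  have "lin_ext (\<lambda>(p, (u, v), s). bas ((p, u), (v, s))) (tens (bas p) (tens x (bas s)))
      = lin_ext (\<lambda>(u, v). bas ((p, u), (v, s))) x" for x :: "'u \<times> 'v \<Rightarrow>\<^sub>0 'k"
    by (rule lin_eqI[of "\<lambda>x. lin_ext (\<lambda>(p, (u, v), s). bas ((p, u), (v, s))) (tens (bas p) (tens x (bas s)))"])
       ((intro lin_tensI lin_id)+, auto)
  then show ?thesis
    by (simp add: mid_def)
qed

lemma quadrilin_eqI:
  assumes "\<And>b c d. lin (\<lambda>a. F a b c d)" "\<And>a c d. lin (\<lambda>b. F a b c d)"
    "\<And>a b d. lin (\<lambda>c. F a b c d)" "\<And>a b c. lin (\<lambda>d. F a b c d)"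
    "\<And>b c d. lin (\<lambda>a. G a b c d)" "\<And>a c d. lin (\<lambda>b. G a b c d)"
    "\<And>a b d. lin (\<lambda>c. G a b c d)" "\<And>a b c. lin (\<lambda>d. G a b c d)"
    and "\<And>i j k l. F (bas i) (bas j) (bas k) (bas l) = G (bas i) (bas j) (bas k) (bas l)"
  shows "F a b c d = G a b c d"
proof -
  have "F (bas i) (bas j) c d = G (bas i) (bas j) c d" for i j
    by (rule bilin_eqI[of "F (bas i) (bas j)" "G (bas i) (bas j)"]) (rule assms)+
  then show ?thesis
    by (rule bilin_eqI[of "\<lambda>a b. F a b c d" "\<lambda>a b. G a b c d", rotated 4]) (rule assms)+
qed

text \<open>The value of \<open>t\<close> on the two inner factors need not be a pure tensor, so its
  basis expansion is inserted between the outer factors.\<close>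

lemma mid_tens:
  assumes t: "lin t"
  shows "mid t (tens (tens p q) (tens r s))
    = lin_ext (\<lambda>(u, v). tens (tens p (bas u)) (tens (bas v) s)) (t (tens q r))"
  by (rule quadrilin_eqI[of "\<lambda>p q r s. mid t (tens (tens p q) (tens r s))"
        "\<lambda>p q r s. lin_ext (\<lambda>(u, v). tens (tens p (bas u)) (tens (bas v) s)) (t (tens q r))"])
     ((intro lin_tensI lin_id lin_comp[OF lin_mid] lin_comp[OF t])+, simp add: mid_bas)

section \<open>The product of a twisted tensor product and its associativity\<close>

locale twisting = A: graded_alg A + B: graded_alg B
  for A :: "('i, 'k::field) galg" and B :: "('j, 'k) galg" +
  fixes \<tau> :: "('j \<times> 'i \<Rightarrow>\<^sub>0 'k) \<Rightarrow> ('i \<times> 'j \<Rightarrow>\<^sub>0 'k)"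
  assumes twisting: "graded_twisting_map A B \<tau>"
begin

abbreviation "TC \<equiv> twisted_tensor A B \<tau>"

lemma lin_\<tau>: "lin \<tau>"
  using twisting by (simp add: graded_twisting_map_def graded_map_def)

lemma \<tau>_hom_comp: "x \<in> hom_comp (tdeg (gdeg B) (gdeg A)) n \<Longrightarrow> \<tau> x \<in> hom_comp (tdeg (gdeg A) (gdeg B)) n"
  using twisting by (auto simp: graded_twisting_map_def graded_map_def)

lemma \<tau>_unit: "\<tau> (tens (gone B) a) = tens a (gone B)" "\<tau> (tens b (gone A)) = tens (gone A) b"
  using twisting by (simp_all add: graded_twisting_map_def)

lemma \<tau>_gmul: "\<tau> (tmap (gmul B) (gmul A) x) = tmap (gmul A) (gmul B) (mid \<tau> (tmap \<tau> \<tau> (mid \<tau> x)))"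
proof -
  have "\<tau> \<circ> tmap (gmul B) (gmul A) = tmap (gmul A) (gmul B) \<circ> mid \<tau> \<circ> tmap \<tau> \<tau> \<circ> mid \<tau>"
    using twisting unfolding graded_twisting_map_def by blast
  from fun_cong[OF this, of x] show ?thesis by simp
qed

text \<open>The outer bimodule structure x \<mapsto> a x b of A \<otimes> B, with A acting on the
  left factor and B on the right one. It lets the product be written as (a \<otimes> b)(a' \<otimes>
  b') = a \<tau>(b \<otimes> a') b', without rebracketing.\<close>

definition LR :: "('i \<Rightarrow>\<^sub>0 'k) \<Rightarrow> ('j \<Rightarrow>\<^sub>0 'k) \<Rightarrow> ('i \<times> 'j \<Rightarrow>\<^sub>0 'k) \<Rightarrow> ('i \<times> 'j \<Rightarrow>\<^sub>0 'k)" where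
  "LR a b = tmap (gprod A a) (\<lambda>x. gprod B x b)"

lemmas lin_gprodI = lin_comp[OF A.lin_left] lin_comp[OF A.lin_right] lin_comp[OF B.lin_left] lin_comp[OF B.lin_right]

lemma lin_LR: "lin (LR a b)"
  by (simp add: LR_def)

lemma lin_LR_left: "lin (\<lambda>a. LR a b x)"
  unfolding LR_def tmap_def by (intro lin_tensI lin_gprodI lin_id)

lemma lin_LR_right: "lin (\<lambda>b. LR a b x)"
  unfolding LR_def tmap_def by (intro lin_tensI lin_gprodI lin_id)

lemma LR_tens: "LR a b (tens x y) = tens (gprod A a x) (gprod B y b)"
  unfolding LR_def by (rule tmap_tens[OF A.lin_right B.lin_left])

lemma LR_bas: "LR a b (bas (i, j)) = tens (gprod A a (bas i)) (gprod B (bas j) b)"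
  by (simp add: LR_tens flip: tens_bas)

lemma LR_LR: "LR a b (LR a' b' x) = LR (gprod A a a') (gprod B b' b) x"
proof (rule lin_eqI[of "\<lambda>x. LR a b (LR a' b' x)" "LR (gprod A a a') (gprod B b' b)"])
  fix p show "LR a b (LR a' b' (bas p)) = LR (gprod A a a') (gprod B b' b) (bas p)"
    by (cases p) (simp add: LR_tens LR_bas A.gprod_assoc B.gprod_assoc)
qed (rule lin_comp[OF lin_LR lin_LR] lin_LR)+

lemma LR_unit [simp]: "LR (gone A) (gone B) x = x"
proof (rule lin_eqI[of "LR (gone A) (gone B)" "\<lambda>x. x"])
  fix p show "LR (gone A) (gone B) (bas p) = bas p"
    by (cases p) (simp add: LR_bas)
qed (auto intro: lin_LR)

lemma lin_gmul: "lin (gmul TC)"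
  unfolding twisted_tensor_def by (simp add: comp_def lin_comp lin_mid)

lemma lin_prod_left: "lin (\<lambda>x. gprod TC x y)"
  unfolding gprod_def by (rule lin_comp[OF lin_gmul lin_tens_left])

lemma lin_prod_right: "lin (gprod TC x)"
  unfolding gprod_def by (rule lin_comp[OF lin_gmul lin_tens_right])

lemmas lin_twistI = lin_tensI lin_gprodI lin_comp[OF lin_\<tau>] lin_comp[OF lin_LR]
  lin_comp[OF lin_LR_left] lin_comp[OF lin_LR_right] lin_comp[OF lin_prod_left] lin_comp[OF lin_prod_right]
  lin_comp[OF lin_mid] lin_id

lemma gmul_bas: "gmul TC (bas ((i, j), (i', j'))) = LR (bas i) (bas j') (\<tau> (bas (j, i')))"
proof -
  have "gmul TC (bas ((i, j), (i', j')))
      = tmap (gmul A) (gmul B) (lin_ext (\<lambda>(u, v). bas ((i, u), (v, j'))) (\<tau> (bas (j, i'))))"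
    by (simp add: twisted_tensor_def mid_bas)
  also have "\<dots> = lin_ext (\<lambda>(u, v). LR (bas i) (bas j') (bas (u, v))) (\<tau> (bas (j, i')))"
    unfolding lin_lin_ext_apply[OF lin_tmap]
    by (rule lin_ext_cong) (auto simp: LR_bas gprod_def)
  also have "\<dots> = LR (bas i) (bas j') (\<tau> (bas (j, i')))"
    by (subst (2) lin_eq_lin_ext[OF lin_LR]) (rule lin_ext_cong, auto)
  finally show ?thesis .
qed

lemma prod_tens: "gprod TC (tens a b) (tens a' b') = LR a b' (\<tau> (tens b a'))"
  by (rule quadrilin_eqI[of "\<lambda>a b a' b'. gprod TC (tens a b) (tens a' b')" "\<lambda>a b a' b'. LR a b' (\<tau> (tens b a'))"])
     ((intro lin_twistI)+, simp add: gmul_bas gprod_def[of TC])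

text \<open>The product of \<open>x\<close> with 1 \<otimes> v, where \<tau> only has to pass the
  unit of A. It is stated for the raw composite because this is how the product occurs in
  \<open>\<tau>_gmul\<close>.\<close>

lemma mult_mid_unit_left: "tmap (gmul A) (gmul B) (mid \<tau> (tens x (tens (gone A) v))) = LR (gone A) v x"
proof (rule lin_eqI[of "\<lambda>x. tmap (gmul A) (gmul B) (mid \<tau> (tens x (tens (gone A) v)))" "LR (gone A) v"])
  fix p :: "'i \<times> 'j"
  obtain i j where p: "p = (i, j)" by force
  have "mid \<tau> (tens (tens (bas i) (bas j)) (tens (gone A) v))
      = lin_ext (\<lambda>(u', v'). tens (tens (bas i) (bas u')) (tens (bas v') v)) (tens (gone A) (bas j))"
    by (simp add: mid_tens[OF lin_\<tau>] \<tau>_unit del: tens_bas)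
  also have "\<dots> = tens (tens (bas i) (gone A)) (tens (bas j) v)"
    by (rule bilin_eqI[of "\<lambda>x y. lin_ext (\<lambda>(u', v'). tens (tens (bas i) (bas u')) (tens (bas v') v)) (tens x y)"
          "\<lambda>x y. tens (tens (bas i) x) (tens y v)"]) ((intro lin_twistI)+, simp)
  finally show "tmap (gmul A) (gmul B) (mid \<tau> (tens (bas p) (tens (gone A) v))) = LR (gone A) v (bas p)"
    by (simp add: p LR_bas tmap_tens[OF A.lin_gmul B.lin_gmul] flip: gprod_def)
qed (intro lin_twistI lin_LR)+

lemma mult_mid_unit_right: "tmap (gmul A) (gmul B) (mid \<tau> (tens (tens u (gone B)) x)) = LR u (gone B) x"
proof (rule lin_eqI[of "\<lambda>x. tmap (gmul A) (gmul B) (mid \<tau> (tens (tens u (gone B)) x))" "LR u (gone B)"])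
  fix p :: "'i \<times> 'j"
  obtain i j where p: "p = (i, j)" by force
  have "mid \<tau> (tens (tens u (gone B)) (tens (bas i) (bas j)))
      = lin_ext (\<lambda>(u', v'). tens (tens u (bas u')) (tens (bas v') (bas j))) (tens (bas i) (gone B))"
    by (simp add: mid_tens[OF lin_\<tau>] \<tau>_unit del: tens_bas)
  also have "\<dots> = tens (tens u (bas i)) (tens (gone B) (bas j))"
    by (rule bilin_eqI[of "\<lambda>x y. lin_ext (\<lambda>(u', v'). tens (tens u (bas u')) (tens (bas v') (bas j))) (tens x y)"
          "\<lambda>x y. tens (tens u x) (tens y (bas j))"]) ((intro lin_twistI)+, simp)
  finally show "tmap (gmul A) (gmul B) (mid \<tau> (tens (tens u (gone B)) (bas p))) = LR u (gone B) (bas p)"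
    by (simp add: p LR_bas tmap_tens[OF A.lin_gmul B.lin_gmul] flip: gprod_def)
qed (intro lin_twistI lin_LR)+

text \<open>The compatibility axiom evaluated on b \<otimes> b' \<otimes> a \<otimes> 1. The unit
  conditions absorb two of the four occurrences of \<tau>, and the other two form a product in the
  twisted algebra.\<close>

lemma \<tau>_mult_left: "\<tau> (tens (gprod B b b') a) = gprod TC (tens (gone A) b) (\<tau> (tens b' a))"
proof -
  have "\<tau> (tens (gprod B b b') a)
      = \<tau> (tmap (gmul B) (gmul A) (tens (tens b b') (tens a (gone A))))"
    by (simp add: tmap_tens[OF B.lin_gmul A.lin_gmul] flip: gprod_def)
  also have "\<dots> = lin_ext (\<lambda>(u, v). LR (gone A) (bas v) (\<tau> (tens b (bas u)))) (\<tau> (tens b' a))"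
    unfolding \<tau>_gmul mid_tens[OF lin_\<tau>] lin_lin_ext_apply[OF lin_tmap] lin_lin_ext_apply[OF lin_mid]
    by (rule lin_ext_cong) (auto simp: tmap_tens[OF lin_\<tau> lin_\<tau>] \<tau>_unit mult_mid_unit_left simp del: tens_bas)
  also have "\<dots> = gprod TC (tens (gone A) b) (\<tau> (tens b' a))"
    by (subst lin_eq_lin_ext[OF lin_prod_right])
       (rule lin_ext_cong, auto simp: prod_tens simp flip: tens_bas)
  finally show ?thesis .
qed

text \<open>The mirror image, with the axiom evaluated on 1 \<otimes> b \<otimes> a \<otimes>
  a'.\<close>

lemma \<tau>_mult_right: "\<tau> (tens b (gprod A a a')) = gprod TC (\<tau> (tens b a)) (tens a' (gone B))"
proof -
  have "\<tau> (tens b (gprod A a a'))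
      = \<tau> (tmap (gmul B) (gmul A) (tens (tens (gone B) b) (tens a a')))"
    by (simp add: tmap_tens[OF B.lin_gmul A.lin_gmul] flip: gprod_def)
  also have "\<dots> = lin_ext (\<lambda>(u, v). LR (bas u) (gone B) (\<tau> (tens (bas v) a'))) (\<tau> (tens b a))"
    unfolding \<tau>_gmul mid_tens[OF lin_\<tau>] lin_lin_ext_apply[OF lin_tmap] lin_lin_ext_apply[OF lin_mid]
    by (rule lin_ext_cong) (auto simp: tmap_tens[OF lin_\<tau> lin_\<tau>] \<tau>_unit mult_mid_unit_right simp del: tens_bas)
  also have "\<dots> = gprod TC (\<tau> (tens b a)) (tens a' (gone B))"
    by (subst lin_eq_lin_ext[OF lin_prod_left])
       (rule lin_ext_cong, auto simp: prod_tens simp flip: tens_bas)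
  finally show ?thesis .
qed

lemma LR_prod_left: "gprod TC (LR a (gone B) x) y = LR a (gone B) (gprod TC x y)"
proof (rule bilin_eqI[of "\<lambda>x y. gprod TC (LR a (gone B) x) y" "\<lambda>x y. LR a (gone B) (gprod TC x y)"])
  fix p q
  show "gprod TC (LR a (gone B) (bas p)) (bas q) = LR a (gone B) (gprod TC (bas p) (bas q))"
    by (cases p; cases q) (simp add: LR_tens prod_tens LR_LR flip: tens_bas)
qed (intro lin_twistI lin_prod_right)+

lemma LR_prod_right: "gprod TC x (LR (gone A) b y) = LR (gone A) b (gprod TC x y)"
proof (rule bilin_eqI[of "\<lambda>x y. gprod TC x (LR (gone A) b y)" "\<lambda>x y. LR (gone A) b (gprod TC x y)"])
  fix p q
  show "gprod TC (bas p) (LR (gone A) b (bas q)) = LR (gone A) b (gprod TC (bas p) (bas q))"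
    by (cases p; cases q) (simp add: LR_tens prod_tens LR_LR flip: tens_bas)
qed (intro lin_twistI lin_prod_right)+

text \<open>A special case of associativity: x b' is x (1 \<otimes> b'), and (1 \<otimes> b')(a'
  \<otimes> 1) is \<tau>(b' \<otimes> a'). After the A-factor of \<open>x\<close> is pulled out on
  the left, it is exactly \<open>\<tau>_mult_left\<close>.\<close>

lemma prod_LR_tens_unit:
  "gprod TC (LR (gone A) b' x) (tens a' (gone B)) = gprod TC x (\<tau> (tens b' a'))"
proof (rule lin_eqI[of "\<lambda>x. gprod TC (LR (gone A) b' x) (tens a' (gone B))" "\<lambda>x. gprod TC x (\<tau> (tens b' a'))"])
  fix p :: "'i \<times> 'j"
  obtain i j where p: "p = (i, j)" by force
  have "gprod TC (bas p) (\<tau> (tens b' a')) = gprod TC (LR (bas i) (gone B) (tens (gone A) (bas j))) (\<tau> (tens b' a'))"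
    by (simp add: LR_tens p)
  then show "gprod TC (LR (gone A) b' (bas p)) (tens a' (gone B)) = gprod TC (bas p) (\<tau> (tens b' a'))"
    by (simp add: LR_prod_left p LR_bas prod_tens \<tau>_mult_left)
qed (intro lin_twistI lin_prod_left)+

text \<open>The dual special case, which rests on \<open>\<tau>_mult_right\<close> after the
  B-factor of \<open>y\<close> is pulled out on the right.\<close>

lemma prod_tens_unit_LR:
  "gprod TC (tens (gone A) b) (LR a (gone B) y) = gprod TC (\<tau> (tens b a)) y"
proof (rule lin_eqI[of "\<lambda>y. gprod TC (tens (gone A) b) (LR a (gone B) y)" "gprod TC (\<tau> (tens b a))"])
  fix p :: "'i \<times> 'j"
  obtain i j where p: "p = (i, j)" by force
  have "gprod TC (\<tau> (tens b a)) (bas p) = gprod TC (\<tau> (tens b a)) (LR (gone A) (bas j) (tens (bas i) (gone B)))"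
    by (simp add: LR_tens p)
  then show "gprod TC (tens (gone A) b) (LR a (gone B) (bas p)) = gprod TC (\<tau> (tens b a)) (bas p)"
    by (simp add: LR_prod_right p LR_bas prod_tens \<tau>_mult_right)
qed (intro lin_twistI lin_prod_right)+

lemma LR_split: "LR a b x = LR a (gone B) (LR (gone A) b x)"
  by (simp add: LR_LR)

lemma LR_swap: "LR (gone A) b (LR a (gone B) x) = LR a (gone B) (LR (gone A) b x)"
  by (simp add: LR_LR)

text \<open>
  Both sides reduce to \<open>a\<^sub>1 * (\<tau>(b\<^sub>1 \<otimes> a\<^sub>2) * \<tau>(b\<^sub>2 \<otimes> a\<^sub>3)) * b\<^sub>3\<close>.
\<close>

lemma prod_assoc_tens:
  "gprod TC (gprod TC (tens a1 b1) (tens a2 b2)) (tens a3 b3)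
    = gprod TC (tens a1 b1) (gprod TC (tens a2 b2) (tens a3 b3))"
proof -
  have t3: "tens a3 b3 = LR (gone A) b3 (tens a3 (gone B))" and t1: "tens a1 b1 = LR a1 (gone B) (tens (gone A) b1)"
    by (simp_all add: LR_tens)
  have "gprod TC (gprod TC (tens a1 b1) (tens a2 b2)) (tens a3 b3)
      = LR a1 (gone B) (LR (gone A) b3 (gprod TC (\<tau> (tens b1 a2)) (\<tau> (tens b2 a3))))"
    unfolding prod_tens[of a1 b1] LR_split[of a1 b2] t3 LR_prod_left LR_prod_right prod_LR_tens_unit
    by (rule LR_swap)
  also have "\<dots> = gprod TC (tens a1 b1) (gprod TC (tens a2 b2) (tens a3 b3))"
    unfolding prod_tens[of a2 b2] LR_split[of a2 b3] t1 LR_prod_left LR_swap[symmetric] LR_prod_right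
      prod_tens_unit_LR ..
  finally show ?thesis .
qed

lemma prod_assoc: "gprod TC (gprod TC x y) z = gprod TC x (gprod TC y z)"
proof -
  have *: "gprod TC (gprod TC (bas p) (bas q)) (bas r) = gprod TC (bas p) (gprod TC (bas q) (bas r))" for p q r
    using prod_assoc_tens by (cases p; cases q; cases r) (simp flip: tens_bas)
  have "gprod TC (gprod TC (bas p) y) z = gprod TC (bas p) (gprod TC y z)" for p
    by (rule bilin_eqI[of "\<lambda>y z. gprod TC (gprod TC (bas p) y) z" "\<lambda>y z. gprod TC (bas p) (gprod TC y z)"])
       ((intro lin_twistI lin_prod_right)+, simp add: *)
  then show ?thesis
    by (rule lin_eqI[of "\<lambda>x. gprod TC (gprod TC x y) z" "\<lambda>x. gprod TC x (gprod TC y z)", rotated 2])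
       (intro lin_twistI lin_prod_left)+
qed

section \<open>The twisted product as a connected graded algebra, and its Hilbert function\<close>

lemma TC_simps [simp]: "gdeg TC = tdeg (gdeg A) (gdeg B)" "gone TC = tens (gone A) (gone B)"
  by (simp_all add: twisted_tensor_def)

lemma prod_unit: "gprod TC (gone TC) x = x" "gprod TC x (gone TC) = x"
proof -
  show "gprod TC (gone TC) x = x"
  proof (rule lin_eqI[of "gprod TC (gone TC)" "\<lambda>x. x"])
    fix p show "gprod TC (gone TC) (bas p) = bas p"
      by (cases p) (simp add: prod_tens \<tau>_unit LR_tens flip: tens_bas)
  qed (auto intro: lin_prod_right)
  show "gprod TC x (gone TC) = x"
  proof (rule lin_eqI[of "\<lambda>x. gprod TC x (gone TC)" "\<lambda>x. x"])
    fix p show "gprod TC (bas p) (gone TC) = bas p"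
      by (cases p) (simp add: prod_tens \<tau>_unit LR_tens flip: tens_bas)
  qed (auto intro: lin_prod_left)
qed

lemma gmul_hom_comp:
  assumes "f \<in> hom_comp (tdeg (gdeg TC) (gdeg TC)) n"
  shows "gmul TC f \<in> hom_comp (gdeg TC) n"
  unfolding hom_comp_eq_coord_space
proof (rule lin_in_subspace[OF lin_gmul subspace_coord_space])
  fix x assume "x \<in> Poly_Mapping.keys f"
  moreover obtain i j i' j' where x: "x = ((i, j), (i', j'))" by (metis surj_pair)
  ultimately have n: "gdeg A i + gdeg B j + (gdeg A i' + gdeg B j') = n"
    using assms by (auto simp: hom_comp_def tdeg_def)
  have t: "\<tau> (bas (j, i')) \<in> hom_comp (tdeg (gdeg A) (gdeg B)) (gdeg B j + gdeg A i')"
    by (rule \<tau>_hom_comp) (simp add: hom_comp_def tdeg_def)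
  have "LR (bas i) (bas j') (\<tau> (bas (j, i'))) \<in> coord_space {p. gdeg TC p = n}"
  proof (rule lin_in_subspace[OF lin_LR subspace_coord_space])
    fix p assume p: "p \<in> Poly_Mapping.keys (\<tau> (bas (j, i')))"
    obtain u v where uv: "p = (u, v)" by force
    have "gdeg A u + gdeg B v = gdeg B j + gdeg A i'"
      using t p uv by (auto simp: hom_comp_def tdeg_def)
    then have *: "gdeg A i + gdeg A u + (gdeg B v + gdeg B j') = n" using n by simp
    show "LR (bas i) (bas j') (bas p) \<in> coord_space {p. gdeg TC p = n}"
      unfolding uv LR_bas
    proof (rule tens_in_coord_space)
      show "gprod A (bas i) (bas u) \<in> coord_space {k. gdeg A k = gdeg A i + gdeg A u}"
        using A.gprod_hom_comp[OF A.bas_hom_comp A.bas_hom_comp] by (simp add: hom_comp_eq_coord_space)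
      show "gprod B (bas v) (bas j') \<in> coord_space {k. gdeg B k = gdeg B v + gdeg B j'}"
        using B.gprod_hom_comp[OF B.bas_hom_comp B.bas_hom_comp] by (simp add: hom_comp_eq_coord_space)
    qed (use * in \<open>auto simp: tdeg_def\<close>)
  qed
  then show "gmul TC (bas x) \<in> coord_space {p. gdeg TC p = n}"
    by (simp add: x gmul_bas)
qed

lemma deg_TC_eq: "{p. gdeg TC p = n} = (\<Union>k\<le>n. {i. gdeg A i = k} \<times> {j. gdeg B j = n - k})"
  by (auto simp: tdeg_def)

lemma hom_comp_0_TC: "hom_comp (gdeg TC) 0 = range (\<lambda>c. smul c (gone TC))"
proof -
  have keys: "Poly_Mapping.keys (gone TC) = {(A.i0, B.i0)}"
    by (simp add: keys_tens A.keys_unit B.keys_unit)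
  have deg: "gdeg TC p = 0 \<longleftrightarrow> p = (A.i0, B.i0)" for p
    by (cases p) (simp add: tdeg_def A.deg_0_iff B.deg_0_iff)
  show ?thesis
  proof (intro subset_antisym subsetI)
    fix f :: "'i \<times> 'j \<Rightarrow>\<^sub>0 'k" assume f: "f \<in> hom_comp (gdeg TC) 0"
    let ?x = "(A.i0, B.i0)" and ?l = Poly_Mapping.lookup
    \<comment> \<open>Only one basis vector has degree 0, and the unit is a nonzero multiple of it,
      so comparing this single coefficient determines the scalar.\<close>
    have "f = smul (?l f ?x / ?l (gone TC) ?x) (gone TC)"
    proof (rule poly_mapping_eqI)
      fix p
      show "?l f p = ?l (smul (?l f ?x / ?l (gone TC) ?x) (gone TC)) p"
      proof (cases "p = ?x")
        case True
        have "?l (gone TC) ?x \<noteq> 0" using keys by (metis in_keys_iff insertI1)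
        then show ?thesis using True by (simp del: TC_simps)
      next
        case False
        then have "p \<notin> Poly_Mapping.keys f" "p \<notin> Poly_Mapping.keys (gone TC)"
          using f keys deg by (auto simp: hom_comp_def)
        then show ?thesis by (simp add: in_keys_iff del: TC_simps)
      qed
    qed
    then show "f \<in> range (\<lambda>c. smul c (gone TC))" by blast
  next
    fix f assume "f \<in> range (\<lambda>c. smul c (gone TC))"
    then obtain c where c: "f = smul c (gone TC)" by blast
    have "Poly_Mapping.keys f \<subseteq> {(A.i0, B.i0)}"
      using keys_smul[of c "gone TC"] unfolding c keys .
    then show "f \<in> hom_comp (gdeg TC) 0"
      using deg by (auto simp: hom_comp_def)
  qed
qed

lemma graded_algebra_TC: "graded_algebra TC"
  unfolding graded_algebra_def graded_map_def
  using lin_gmul gmul_hom_comp prod_assoc prod_unit hom_comp_0_TC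
    finite_UN_I[of "{..n}" "\<lambda>k. {i. gdeg A i = k} \<times> {j. gdeg B j = n - k}" for n]
  by (simp add: deg_TC_eq A.finite_deg B.finite_deg image_subset_iff del: TC_simps)

text \<open>The underlying graded space is A \<otimes> B, so the Hilbert series is the product of
  the two series; this is the Cauchy product formula for its coefficients.\<close>

lemma card_deg_TC:
  "card {p. gdeg TC p = n} = (\<Sum>k\<le>n. card {i. gdeg A i = k} * card {j. gdeg B j = n - k})"
  unfolding deg_TC_eq
  by (subst card_UN_disjoint) (auto simp: A.finite_deg B.finite_deg card_cartesian_product)

end

section \<open>Hilbert functions of one-generated free algebras\<close>

lemma card_deg_one_generated_free:
  fixes C :: "('i, 'k::field) galg"
  assumes "one_generated_free C"
  obtains m where "\<And>n. card {i. gdeg C i = n} = m ^ n"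
proof -
  obtain X :: "nat set" and \<phi> :: "(nat list \<Rightarrow>\<^sub>0 'k) \<Rightarrow> ('i \<Rightarrow>\<^sub>0 'k)" where fin: "finite X" and lin: "lin \<phi>"
    and iso: "\<phi> \<in> ring_iso (tensor_algebra X) (galg_ring C)"
    and hom: "\<And>n. \<phi> ` (carrier (tensor_algebra X) \<inter> hom_comp length n) \<subseteq> hom_comp (gdeg C) n"
    using assms unfolding one_generated_free_def by blast
  have bij: "bij_betw \<phi> (coord_space (lists X)) UNIV"
    using iso by (simp add: ring_iso_def galg_ring_def)
  \<comment> \<open>For empty \<open>X\<close> the convention 0 ^ 0 = 1 gives the Hilbert function
    of the ground field, as it should.\<close>
  have "card {i. gdeg C i = n} = card X ^ n" for n
  proof -
    let ?W = "{w. set w \<subseteq> X \<and> length w = n}"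
    let ?V = "coord_space ?W :: (nat list \<Rightarrow>\<^sub>0 'k) set"
    have V: "?V = coord_space (lists X) \<inter> hom_comp length n"
      by (auto simp: coord_space_def hom_comp_def lists_eq_set)
    have inj: "{f \<in> ?V. \<phi> f = 0} = coord_space {}"
    proof -
      have "f = 0" if "f \<in> ?V" "\<phi> f = 0" for f
        using bij that inj_onD[of \<phi> "coord_space (lists X)" f 0]
        by (simp add: bij_betw_def V lin_zero[OF lin])
      then show ?thesis using lin_zero[OF lin] by (auto simp: coord_space_def)
    qed
    have "\<phi> ` ?V = hom_comp (gdeg C) n"
    proof (intro subset_antisym subsetI)
      fix y :: "'i \<Rightarrow>\<^sub>0 'k" assume "y \<in> \<phi> ` ?V"
      then show "y \<in> hom_comp (gdeg C) n" using hom[of n] by (auto simp: V)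
    next
      fix y :: "'i \<Rightarrow>\<^sub>0 'k" assume y: "y \<in> hom_comp (gdeg C) n"
      obtain f where f: "f \<in> coord_space (lists X)" "y = \<phi> f"
        using bij unfolding bij_betw_def by (metis UNIV_I imageE)
      \<comment> \<open>The definition only says that \<phi> maps each degree into the same degree.
        That it is onto in each degree follows by projecting a preimage.\<close>
      have "\<phi> (hproj length n f) = hproj (gdeg C) n (\<phi> f)"
      proof (rule hproj_commute[OF lin])
        fix w assume "w \<in> Poly_Mapping.keys f"
        then have "bas w \<in> carrier (tensor_algebra X) \<inter> (hom_comp length (length w) :: (nat list \<Rightarrow>\<^sub>0 'k) set)"
          using f(1) by (auto simp: coord_space_def hom_comp_def)
        then show "\<phi> (bas w) \<in> hom_comp (gdeg C) (length w)" using hom by blast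
      qed
      then have "\<phi> (hproj length n f) = y" using f(2) hproj_hom_comp[OF y] by simp
      moreover have "hproj length n f \<in> ?V"
        by (rule coord_space_mono[OF hproj_in_coord_space[OF f(1)]]) auto
      ultimately show "y \<in> \<phi> ` ?V" by blast
    qed
    then have "vs.dim ?V = vs.dim (coord_space {i. gdeg C i = n} :: ('i \<Rightarrow>\<^sub>0 'k) set)"
      using rank_nullity[OF lin subspace_coord_space subset_refl finite_lists_length_eq[OF fin], of n] inj
      by (simp add: hom_comp_eq_coord_space dim_coord_space)
    then show ?thesis
      using card_lists_length_eq[OF fin, of n] by (simp add: dim_coord_space)
  qed
  then show ?thesis using that by blast
qed

theorem proposition5p5:
  fixes A :: "('i, 'k::field) galg" and B :: "('j, 'k) galg"
    and \<tau> :: "('j \<times> 'i \<Rightarrow>\<^sub>0 'k) \<Rightarrow> ('i \<times> 'j \<Rightarrow>\<^sub>0 'k)"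
  assumes "graded_algebra A" and "one_generated_free A"
    and "graded_algebra B" and "one_generated_free B"
    and "graded_twisting_map A B \<tau>"
    and "quadratic (twisted_tensor A B \<tau>)"
  shows "koszul (twisted_tensor A B \<tau>)"
proof -
  interpret twisting A B \<tau>
    by unfold_locales (fact assms)+
  obtain a where a: "\<And>n. card {i. gdeg A i = n} = a ^ n"
    using card_deg_one_generated_free[OF assms(2)] by blast
  obtain b where b: "\<And>n. card {j. gdeg B j = n} = b ^ n"
    using card_deg_one_generated_free[OF assms(4)] by blast
  define c where "c n = card {p. gdeg TC p = n}" for n
  have c: "c n = (\<Sum>k\<le>n. a ^ k * b ^ (n - k))" for n
    by (simp add: c_def card_deg_TC a b del: TC_simps)
  \<comment> \<open>The term k = 0 is split off. In terms of the series H this says (1 - a t) H = 1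
    / (1 - b t).\<close>
  have c_Suc: "c (Suc n) = a * c n + b ^ Suc n" for n
    unfolding c by (subst sum.atMost_Suc_shift) (simp add: sum_distrib_left mult.assoc)
  have c_1: "c 1 = a + b" by (simp add: c)
  \<comment> \<open>The coefficient of t^(m+2) in (1 - a t)(1 - b t) H = 1, written without
    subtraction. It results from using \<open>c_Suc\<close> twice, since b c(m+1) = a b c(m) +
    b^(m+2). The number \<open>r\<close> of relations is thus a b.\<close>
  have "c (m + 2) + a * b * c m = c 1 * c (m + 1)" for m
    unfolding c_1 by (simp add: c_Suc algebra_simps)
  then show ?thesis
    unfolding c_def
    by (rule koszul_if_quadratic_and_hilbert_recursion[OF graded_algebra_TC assms(6)])
qed

end
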